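(* Let $A=(a_{k-l})_{k,l\in\mathbb Z}$ be a hermitian positive definite biinfinite Toeplitz matrix with inverse $A^{-1}=(\alpha_{k-l})_{k,l\in\mathbb Z}$. Let $v:\mathbb Z\to(0,\infty)$ be a weight function with $$v(k+l)\le v(k)v(l)\qquad\text{for all }k,l\in\mathbb Z,$$ such that $$\sum_{k=-\infty}^{\infty}|a_k|\,v(k)<\infty .$$ If $$\lim_{n\to\infty}\frac{1}{\sqrt[n]{v(-n)}}=1\quad\text{and}\quad \lim_{n\to\infty}\sqrt[n]{v(n)}=1,$$ then $$\sum_{k=-\infty}^{\infty}|\alpha_k|\,v(k)<\infty .$$ In particular, for a hermitian positive definite biinfinite Toeplitz matrix $A$: if $A\in\mathcal Q_s$ for some $s>1$, then $A^{-1}\in\mathcal Q_s$; and if $A\in\mathcal E_{\gamma,\lambda}$ for some $\gamma>0$ and $0<\lambda<1$, then $A^{-1}\in\mathcal E_{\gamma,\lambda}$ (with the same $\gamma$ and $\lambda$).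
   Context: A biinfinite Toeplitz matrix $A=(a_{k-l})_{k,l\in\mathbb Z}$ is regarded as a (bounded) operator on $\ell^2(\mathbb Z)$; hermitian positive definite means self-adjoint, positive and boundedly invertible on $\ell^2(\mathbb Z)$. The inverse of such an operator is again a biinfinite Toeplitz matrix, with entries written $(A^{-1})_{kl}=\alpha_{k-l}$. For $\gamma,\lambda>0$, a matrix $A=[A_{kl}]_{k,l\in\mathbb Z}$ belongs to $\mathcal E_{\gamma,\lambda}$ if there is a constant $c>0$ with $|A_{kl}|<c\,e^{-\gamma|k-l|^{\lambda}}$ for all $k,l$. For $s>1$, $A$ belongs to $\mathcal Q_s$ if there is a constant $c>0$ with $|A_{kl}|<c\,(1+|k-l|)^{-s}$ for all $k,l$. *)

theory Defs
  imports "HOL-Analysis.Analysis"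
begin

text \<open>Biinfinite matrices are functions \<open>int \<Rightarrow> int \<Rightarrow> complex\<close>, and the Hilbert space
  of square-summable sequences over the integers is represented by a carrier set.\<close>

definition ell2 :: "(int \<Rightarrow> complex) set" where
  "ell2 = {x. (\<lambda>k. (cmod (x k))\<^sup>2) summable_on UNIV}"

definition ell2_norm :: "(int \<Rightarrow> complex) \<Rightarrow> real" where
  "ell2_norm x = sqrt (\<Sum>\<^sub>\<infinity>k. (cmod (x k))\<^sup>2)"

definition ell2_inner :: "(int \<Rightarrow> complex) \<Rightarrow> (int \<Rightarrow> complex) \<Rightarrow> complex" where
  "ell2_inner x y = (\<Sum>\<^sub>\<infinity>k. x k * cnj (y k))"

definition ell2_bounded_operator :: "((int \<Rightarrow> complex) \<Rightarrow> (int \<Rightarrow> complex)) \<Rightarrow> bool" where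
  "ell2_bounded_operator T \<longleftrightarrow>
     (\<forall>x\<in>ell2. T x \<in> ell2) \<and>
     (\<forall>x\<in>ell2. \<forall>y\<in>ell2. T (\<lambda>k. x k + y k) = (\<lambda>k. T x k + T y k)) \<and>
     (\<forall>c. \<forall>x\<in>ell2. T (\<lambda>k. c * x k) = (\<lambda>k. c * T x k)) \<and>
     (\<exists>C. \<forall>x\<in>ell2. ell2_norm (T x) \<le> C * ell2_norm x)"

definition matrix_operator :: "(int \<Rightarrow> int \<Rightarrow> complex) \<Rightarrow> (int \<Rightarrow> complex) \<Rightarrow> (int \<Rightarrow> complex)" where
  "matrix_operator A x = (\<lambda>k. \<Sum>\<^sub>\<infinity>l. A k l * x l)"

text \<open>Convergence of the row sums is demanded explicitly, since \<open>infsum\<close> is \<open>0\<close> on families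
  that are not summable.\<close>

definition ell2_bounded_matrix :: "(int \<Rightarrow> int \<Rightarrow> complex) \<Rightarrow> bool" where
  "ell2_bounded_matrix A \<longleftrightarrow>
     (\<forall>x\<in>ell2. \<forall>k. (\<lambda>l. A k l * x l) summable_on UNIV) \<and>
     ell2_bounded_operator (matrix_operator A)"

definition ell2_boundedly_invertible :: "((int \<Rightarrow> complex) \<Rightarrow> (int \<Rightarrow> complex)) \<Rightarrow> bool" where
  "ell2_boundedly_invertible T \<longleftrightarrow>
     (\<exists>S. ell2_bounded_operator S \<and> (\<forall>x\<in>ell2. S (T x) = x \<and> T (S x) = x))"

definition hermitian_positive_definite :: "(int \<Rightarrow> int \<Rightarrow> complex) \<Rightarrow> bool" where
  "hermitian_positive_definite A \<longleftrightarrow>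
     ell2_bounded_matrix A \<and>
     (\<forall>x\<in>ell2. \<forall>y\<in>ell2.
        ell2_inner (matrix_operator A x) y = ell2_inner x (matrix_operator A y)) \<and>
     (\<forall>x\<in>ell2. ell2_inner (matrix_operator A x) x \<in> \<real> \<and>
        0 \<le> Re (ell2_inner (matrix_operator A x) x)) \<and>
     ell2_boundedly_invertible (matrix_operator A)"

text \<open>The matrix of the inverse operator in the standard basis: column \<open>l\<close> is the preimage
  of the \<open>l\<close>-th unit vector. It is meaningful only if \<open>A\<close> acts bijectively on \<open>ell2\<close>.\<close>

definition inverse_matrix :: "(int \<Rightarrow> int \<Rightarrow> complex) \<Rightarrow> (int \<Rightarrow> int \<Rightarrow> complex)" where
  "inverse_matrix A = (\<lambda>k l. inv_into ell2 (matrix_operator A) (indicator {l}) k)"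

definition toeplitz :: "(int \<Rightarrow> complex) \<Rightarrow> (int \<Rightarrow> int \<Rightarrow> complex)" where
  "toeplitz a = (\<lambda>k l. a (k - l))"

definition exp_decay :: "real \<Rightarrow> real \<Rightarrow> (int \<Rightarrow> int \<Rightarrow> complex) set" where
  "exp_decay \<gamma> \<beta> =
     {A. \<exists>c>0. \<forall>k l. cmod (A k l) < c * exp (- \<gamma> * (real_of_int \<bar>k - l\<bar> powr \<beta>))}"

definition poly_decay :: "real \<Rightarrow> (int \<Rightarrow> int \<Rightarrow> complex) set" where
  "poly_decay s =
     {A. \<exists>c>0. \<forall>k l. cmod (A k l) < c * (1 + real_of_int \<bar>k - l\<bar>) powr (- s)}"

lemma inj_on_ell2_boundedly_invertible:
  assumes "ell2_boundedly_invertible T"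
  shows "inj_on T ell2"
  using assms unfolding ell2_boundedly_invertible_def by (metis inj_onI)

lemma ell2_shift:
  assumes "x \<in> ell2"
  shows "(\<lambda>k. x (k - m)) \<in> ell2"
proof -
  have "bij_betw (\<lambda>k::int. k - m) UNIV UNIV"
    by (rule bij_betw_byWitness[where f' = "\<lambda>k. k + m"]) auto
  from summable_on_reindex_bij_betw[OF this, of "\<lambda>k. (cmod (x k))\<^sup>2"] show ?thesis
    using assms by (simp add: ell2_def)
qed

lemma matrix_operator_toeplitz_shift:
  "matrix_operator (toeplitz a) (\<lambda>k. x (k - m)) = (\<lambda>k. matrix_operator (toeplitz a) x (k - m))"
proof
  fix k
  have "bij_betw (\<lambda>l::int. l - m) UNIV UNIV"
    by (rule bij_betw_byWitness[where f' = "\<lambda>l. l + m"]) auto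
  from infsum_reindex_bij_betw[OF this, of "\<lambda>l. a (k - m - l) * x l"]
  show "matrix_operator (toeplitz a) (\<lambda>k. x (k - m)) k = matrix_operator (toeplitz a) x (k - m)"
    by (simp add: matrix_operator_def toeplitz_def)
qed

lemma inverse_matrix_toeplitz:
  assumes "hermitian_positive_definite (toeplitz a)"
  shows "\<exists>\<alpha>. inverse_matrix (toeplitz a) = toeplitz \<alpha>"
proof -
  let ?T = "matrix_operator (toeplitz a)"
  have bi: "ell2_boundedly_invertible ?T"
    using assms by (simp add: hermitian_positive_definite_def)
  have inj: "inj_on ?T ell2"
    using bi by (rule inj_on_ell2_boundedly_invertible)
  have "(indicator {0} :: int \<Rightarrow> complex) \<in> ell2"
  proof -
    have "(\<lambda>k::int. (cmod (indicator {0} k))\<^sup>2) summable_on {0}"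
      by simp
    then have "(\<lambda>k::int. (cmod (indicator {0} k))\<^sup>2) summable_on UNIV"
      by (rule summable_on_cong_neutral[THEN iffD1, rotated 3]) auto
    then show ?thesis by (simp add: ell2_def)
  qed
  then obtain y where y: "y \<in> ell2" "?T y = indicator {0}"
    using bi unfolding ell2_boundedly_invertible_def ell2_bounded_operator_def by blast
  have "inv_into ell2 ?T (indicator {l}) = (\<lambda>k. y (k - l))" for l
  proof (rule inv_into_f_eq[OF inj])
    show "(\<lambda>k. y (k - l)) \<in> ell2" by (rule ell2_shift[OF y(1)])
    show "?T (\<lambda>k. y (k - l)) = indicator {l}"
      by (simp add: matrix_operator_toeplitz_shift y(2) fun_eq_iff indicator_def)
  qed
  then have "inverse_matrix (toeplitz a) = toeplitz y"
    by (simp add: inverse_matrix_def toeplitz_def)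
  then show ?thesis by blast
qed

end

theory Submission
  imports Defs "HOL-Real_Asymp.Real_Asymp"
begin

text \<open>Positivity and invertibility give \<open>M > 0\<close> such that \<open>b = \<delta>\<^sub>0 - a / M\<close> has norm \<open>r < 1\<close> as a
  convolution operator on \<open>\<ell>\<^sup>2\<close>, so \<open>\<alpha> = (1 / M) \<Sum>\<^sub>n b\<^sup>n\<close>. The point is that the spectral radius of
  \<open>b\<close> in the weighted algebra \<open>\<ell>\<^sup>1\<^sub>v\<close> is also at most \<open>r\<close>. If \<open>b\<close> is supported in \<open>[-K, K]\<close>, this
  holds because \<open>b\<^sup>n\<close> has entries of size at most \<open>r\<^sup>n\<close> on \<open>[-nK, nK]\<close>, where \<open>v\<close> grows
  subexponentially in \<open>n\<close>; in general \<open>b\<close> is a finitely supported sequence plus a small one, and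
  the algebra is commutative.

  For a decay rate \<open>u\<close>, choose the weight \<open>v\<close> so that \<open>u(i) \<le> v(j) u(i + j)\<close> whenever
  \<open>\<bar>j\<bar> \<le> \<bar>i\<bar>\<close>. Then \<open>\<parallel>x * y\<parallel>\<^sub>u \<le> \<parallel>x\<parallel>\<^sub>u \<parallel>y\<parallel>\<^sub>v + \<parallel>y\<parallel>\<^sub>u \<parallel>x\<parallel>\<^sub>v\<close>, with the supremum norm relative to
  \<open>u\<close>. With \<open>p\<close> a truncation of \<open>\<alpha>\<close>, the sequence \<open>e = p * a - \<delta>\<^sub>0\<close> is small in \<open>\<ell>\<^sup>1\<^sub>v\<close>, and the
  iteration \<open>x \<mapsto> p - e * x\<close> stays bounded relative to \<open>u\<close> and converges to \<open>\<alpha>\<close>.\<close>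

no_notation Infinite_Set_Sum.abs_summable_on (infix \<open>abs'_summable'_on\<close> 50)

subsection \<open>Convolution on the integers\<close>

definition conv :: "(int \<Rightarrow> complex) \<Rightarrow> (int \<Rightarrow> complex) \<Rightarrow> int \<Rightarrow> complex" where
  "conv x y k = (\<Sum>\<^sub>\<infinity>l. x (k - l) * y l)"

lemma matrix_operator_toeplitz: "matrix_operator (toeplitz a) = conv a"
  by (simp add: matrix_operator_def toeplitz_def conv_def fun_eq_iff)

lemma bij_int_reflect: "bij_betw (\<lambda>l::int. k - l) UNIV UNIV"
  by (rule bij_betw_byWitness[where f' = "\<lambda>l. k - l"]) auto

lemma bij_int_shift: "bij_betw (\<lambda>l::int. l - k) UNIV UNIV"
  by (rule bij_betw_byWitness[where f' = "\<lambda>l. l + k"]) auto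

text \<open>The substitution \<open>l \<mapsto> k - l\<close> is a bijection of the integers, and
  \<open>infsum\<close> is invariant under bijective reindexing even where it takes its default
  value 0, so the identity is unconditional.\<close>

lemma conv_commute: "conv x y = conv y x"
proof
  fix k
  show "conv x y k = conv y x k"
    using infsum_reindex_bij_betw[OF bij_int_reflect[of k], of "\<lambda>l. y (k - l) * x l"]
    by (simp add: conv_def mult.commute)
qed

lemma abs_summable_reflect:
  fixes x :: "int \<Rightarrow> complex"
  shows "x abs_summable_on UNIV \<Longrightarrow> (\<lambda>l. x (k - l)) abs_summable_on UNIV"
  using summable_on_reindex_bij_betw[OF bij_int_reflect[of k], of "\<lambda>l. norm (x l)"] by simp

lemma abs_summable_mult_bounded:
  fixes x z :: "'a \<Rightarrow> complex"
  assumes "x abs_summable_on A" and "\<And>k. cmod (z k) \<le> Z"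
  shows "(\<lambda>l. x l * z l) abs_summable_on A"
proof (rule Infinite_Sum.abs_summable_on_comparison_test'[where g = "\<lambda>l. norm (x l) * Z"])
  show "(\<lambda>l. norm (x l) * Z) summable_on A"
    by (rule summable_on_cmult_left) (use assms in simp)
qed (use assms in \<open>auto simp: norm_mult intro!: mult_left_mono\<close>)

lemma abs_summable_conv_kernel:
  fixes x z :: "int \<Rightarrow> complex"
  assumes "x abs_summable_on UNIV" and "\<And>k. cmod (z k) \<le> Z"
  shows "(\<lambda>l. x (k - l) * z l) abs_summable_on UNIV"
  by (rule abs_summable_mult_bounded[OF abs_summable_reflect[OF assms(1)] assms(2)])

lemma abs_summable_imp_bounded:
  fixes x :: "int \<Rightarrow> complex"
  assumes "x abs_summable_on UNIV"
  shows "cmod (x k) \<le> (\<Sum>\<^sub>\<infinity>k. cmod (x k))"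
  using finite_sum_le_infsum[OF assms, of "{k}"] by simp

lemma norm_conv_le:
  assumes "x abs_summable_on UNIV" and "\<And>k. cmod (z k) \<le> Z"
  shows "cmod (conv x z k) \<le> (\<Sum>\<^sub>\<infinity>k. cmod (x k)) * Z"
proof -
  have "cmod (conv x z k) \<le> (\<Sum>\<^sub>\<infinity>l. cmod (x (k - l) * z l))"
    unfolding conv_def by (rule norm_infsum_bound[OF abs_summable_conv_kernel[OF assms]])
  also have "\<dots> \<le> (\<Sum>\<^sub>\<infinity>l. cmod (x (k - l)) * Z)"
    by (rule infsum_mono[OF abs_summable_conv_kernel[OF assms]])
      (use assms abs_summable_reflect[OF assms(1)] in
        \<open>auto simp: norm_mult intro!: mult_left_mono summable_on_cmult_left\<close>)
  also have "\<dots> = (\<Sum>\<^sub>\<infinity>k. cmod (x k)) * Z"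
    using infsum_reindex_bij_betw[OF bij_int_reflect[of k], of "\<lambda>l. cmod (x l)"]
    by (simp add: infsum_cmult_left')
  finally show ?thesis .
qed

text \<open>The Fubini condition behind associativity. The last factor is only bounded because the
  inverse column \<open>\<alpha>\<close> is at first known merely to lie in
  \<open>ell2\<close>.\<close>

lemma abs_summable_conv_pair:
  fixes x y z :: "int \<Rightarrow> complex"
  assumes "x abs_summable_on UNIV" "y abs_summable_on UNIV" and z: "\<And>k. cmod (z k) \<le> Z"
  shows "(\<lambda>(j, l). x (k - j) * y (j - l) * z l) abs_summable_on (UNIV \<times> UNIV)"
proof -
  have Y: "(\<lambda>l. x (k - j) * y (j - l) * z l) abs_summable_on UNIV" for j
    using abs_summable_conv_kernel[OF assms(2) z, of j]
    by (simp add: mult.assoc norm_mult summable_on_cmult_right)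
  have "(\<lambda>j. (\<Sum>\<^sub>\<infinity>l. cmod (x (k - j) * y (j - l) * z l))) abs_summable_on UNIV"
  proof (rule Infinite_Sum.abs_summable_on_comparison_test'
      [where g = "\<lambda>j. cmod (x (k - j)) * ((\<Sum>\<^sub>\<infinity>l. cmod (y l)) * Z)"])
    show "(\<lambda>j. cmod (x (k - j)) * ((\<Sum>\<^sub>\<infinity>l. cmod (y l)) * Z)) summable_on UNIV"
      by (rule summable_on_cmult_left) (rule abs_summable_reflect[OF assms(1)])
    fix j
    have "(\<Sum>\<^sub>\<infinity>l. cmod (y (j - l) * z l)) \<le> (\<Sum>\<^sub>\<infinity>l. cmod (y (j - l)) * Z)"
      by (rule infsum_mono[OF abs_summable_conv_kernel[OF assms(2) z]])
        (use z abs_summable_reflect[OF assms(2)] in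
          \<open>auto simp: norm_mult intro!: mult_left_mono summable_on_cmult_left\<close>)
    also have "\<dots> = (\<Sum>\<^sub>\<infinity>k. cmod (y k)) * Z"
      using infsum_reindex_bij_betw[OF bij_int_reflect[of j], of "\<lambda>l. cmod (y l)"]
      by (simp add: infsum_cmult_left')
    finally have "(\<Sum>\<^sub>\<infinity>l. cmod (y (j - l) * z l)) \<le> (\<Sum>\<^sub>\<infinity>k. cmod (y k)) * Z" .
    then show "norm (\<Sum>\<^sub>\<infinity>l. cmod (x (k - j) * y (j - l) * z l))
        \<le> cmod (x (k - j)) * ((\<Sum>\<^sub>\<infinity>l. cmod (y l)) * Z)"
      by (simp add: norm_mult mult.assoc infsum_cmult_right' infsum_nonneg mult_left_mono)
  qed
  with Y show ?thesis
    unfolding Infinite_Sum.abs_summable_on_Sigma_iff by simp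
qed

lemma conv_assoc:
  assumes "x abs_summable_on UNIV" "y abs_summable_on UNIV" and z: "\<And>k. cmod (z k) \<le> Z"
  shows "conv (conv x y) z = conv x (conv y z)"
proof
  fix k
  have "conv (conv x y) z k = (\<Sum>\<^sub>\<infinity>l. (\<Sum>\<^sub>\<infinity>j. x (k - j) * y (j - l)) * z l)"
  proof -
    have "conv x y (k - l) = (\<Sum>\<^sub>\<infinity>j. x (k - j) * y (j - l))" for l
      using infsum_reindex_bij_betw[OF bij_int_shift[of l], of "\<lambda>j. x (k - l - j) * y j"]
      by (simp add: conv_def)
    then show ?thesis by (simp add: conv_def[of "conv x y"])
  qed
  also have "\<dots> = (\<Sum>\<^sub>\<infinity>l. (\<Sum>\<^sub>\<infinity>j. x (k - j) * y (j - l) * z l))"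
    by (simp add: infsum_cmult_left')
  also have "\<dots> = (\<Sum>\<^sub>\<infinity>j. (\<Sum>\<^sub>\<infinity>l. x (k - j) * y (j - l) * z l))"
    by (rule infsum_swap_banach[symmetric])
      (rule abs_summable_summable[OF abs_summable_conv_pair[OF assms]])
  also have "\<dots> = conv x (conv y z) k"
    by (simp add: conv_def mult.assoc infsum_cmult_right')
  finally show "conv (conv x y) z k = conv x (conv y z) k" .
qed

lemma conv_abs_summable:
  assumes "x abs_summable_on UNIV" "y abs_summable_on UNIV"
  shows "conv x y abs_summable_on UNIV"
proof -
  \<comment> \<open>With the constant 1 as third factor and \<open>k = 0\<close>, the double family
    consists of the terms of the series \<open>conv x y (- l)\<close>.\<close>
  have "(\<lambda>(j, l). x (0 - j) * y (j - l)) abs_summable_on (UNIV \<times> UNIV)"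
    using abs_summable_conv_pair[OF assms, of "\<lambda>_. 1" 1 0] by simp
  then have "(\<lambda>(l, j). x (- j) * y (j - l)) abs_summable_on (UNIV \<times> UNIV)"
    using summable_on_swap[of "\<lambda>p. norm ((\<lambda>(j, l). x (- j) * y (j - l)) p)" UNIV UNIV]
    by (simp add: case_prod_unfold)
  then have *: "(\<lambda>l. \<Sum>\<^sub>\<infinity>j. cmod (x (- j) * y (j - l))) abs_summable_on UNIV"
    and **: "(\<lambda>j. x (- j) * y (j - l)) abs_summable_on UNIV" for l
    unfolding Infinite_Sum.abs_summable_on_Sigma_iff by simp_all
  have "(\<lambda>l. conv x y (0 - l)) abs_summable_on UNIV"
  proof (rule Infinite_Sum.abs_summable_on_comparison_test[OF *])
    fix l
    have "conv x y (- l) = (\<Sum>\<^sub>\<infinity>j. x (- j) * y (j - l))"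
      using infsum_reindex_bij_betw[OF bij_int_shift[of l], of "\<lambda>j. x (- l - j) * y j"]
      by (simp add: conv_def)
    then show "norm (conv x y (0 - l)) \<le> norm (\<Sum>\<^sub>\<infinity>j. cmod (x (- j) * y (j - l)))"
      using norm_infsum_bound[OF **[of l]] by (simp add: infsum_nonneg)
  qed
  from abs_summable_reflect[OF this, of 0] show ?thesis by simp
qed

lemma conv_add_left:
  assumes "x abs_summable_on UNIV" "y abs_summable_on UNIV" "\<And>k. cmod (z k) \<le> Z"
  shows "conv (\<lambda>k. x k + y k) z = (\<lambda>k. conv x z k + conv y z k)"
  using abs_summable_summable[OF abs_summable_conv_kernel[OF assms(1,3)]]
    abs_summable_summable[OF abs_summable_conv_kernel[OF assms(2,3)]]
  by (simp add: conv_def fun_eq_iff distrib_right infsum_add)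

lemma conv_unit: "conv (indicator {0}) z = z"
proof
  fix k
  have "conv (indicator {0}) z k = infsum (\<lambda>l. indicator {0} (k - l) * z l) {k}"
    unfolding conv_def by (rule infsum_cong_neutral) auto
  then show "conv (indicator {0}) z k = z k" by simp
qed

subsection \<open>The convolution algebra\<close>

text \<open>As a type, the absolutely summable sequences form a commutative ring, so powers,
  geometric sums and ring normalisation apply to convolutions.\<close>

typedef l1 = "{x :: int \<Rightarrow> complex. x abs_summable_on UNIV}"
  morphisms coef Abs_l1
  by (rule exI[of _ "\<lambda>_. 0"]) simp

lemma coef_summable: "coef x abs_summable_on UNIV"
  using coef[of x] by simp

lemma coef_Abs: "x abs_summable_on UNIV \<Longrightarrow> coef (Abs_l1 x) = x"
  by (simp add: Abs_l1_inverse)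

lemma indicator_abs_summable: "(indicator {0} :: int \<Rightarrow> complex) abs_summable_on UNIV"
  by (rule finite_nonzero_values_imp_summable_on, rule finite_subset[of _ "{0}"])
    (auto simp: indicator_def)

lemma coef_bounded: "cmod (coef x k) \<le> (\<Sum>\<^sub>\<infinity>k. cmod (coef x k))"
  by (rule abs_summable_imp_bounded[OF coef_summable])

instantiation l1 :: comm_ring_1
begin

definition "0 = Abs_l1 (\<lambda>_. 0)"
definition "1 = Abs_l1 (indicator {0})"
definition "x + y = Abs_l1 (\<lambda>k. coef x k + coef y k)"
definition "- x = Abs_l1 (\<lambda>k. - coef x k)"
definition "(x::l1) - y = x + - y"
definition "x * y = Abs_l1 (conv (coef x) (coef y))"

lemma coef_0: "coef 0 = (\<lambda>_. 0)"
  by (simp add: zero_l1_def coef_Abs)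

lemma coef_1: "coef 1 = indicator {0}"
  by (simp only: one_l1_def coef_Abs[OF indicator_abs_summable])

lemma coef_add: "coef (x + y) = (\<lambda>k. coef x k + coef y k)"
proof -
  have "(\<lambda>k. coef x k + coef y k) abs_summable_on UNIV"
    by (rule Infinite_Sum.abs_summable_on_comparison_test'[where g = "\<lambda>k. cmod (coef x k) + cmod (coef y k)"])
      (auto intro!: summable_on_add coef_summable norm_triangle_ineq)
  then show ?thesis by (simp add: plus_l1_def coef_Abs)
qed

lemma coef_minus: "coef (- x) = (\<lambda>k. - coef x k)"
  by (simp add: uminus_l1_def coef_Abs coef_summable)

lemma coef_mult: "coef (x * y) = conv (coef x) (coef y)"
  by (simp add: times_l1_def coef_Abs conv_abs_summable coef_summable)

instance
proof
  fix x y z :: l1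
  show "x * y * z = x * (y * z)"
    unfolding coef_inject[symmetric] coef_mult
    by (rule conv_assoc[OF coef_summable coef_summable coef_bounded])
  show "x * y = y * x"
    unfolding coef_inject[symmetric] coef_mult by (rule conv_commute)
  show "1 * x = x"
    unfolding coef_inject[symmetric] coef_mult coef_1 by (rule conv_unit)
  show "(x + y) * z = x * z + y * z"
    unfolding coef_inject[symmetric] coef_mult coef_add
    by (rule conv_add_left[OF coef_summable coef_summable coef_bounded])
  show "(0::l1) \<noteq> 1"
    unfolding coef_inject[symmetric] coef_0 coef_1 by (metis indicator_simps(1) singletonI zero_neq_one)
  show "x + y + z = x + (y + z)"
    by (rule coef_inject[THEN iffD1]) (simp add: coef_add add.assoc)
  show "x + y = y + x"
    by (rule coef_inject[THEN iffD1]) (simp add: coef_add add.commute)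
  show "0 + x = x"
    by (rule coef_inject[THEN iffD1]) (simp add: coef_add coef_0)
  show "- x + x = 0"
    by (rule coef_inject[THEN iffD1]) (simp add: coef_add coef_minus coef_0)
  show "x - y = x + - y"
    by (rule minus_l1_def)
qed

end

lemma coef_diff: "coef (x - y) = (\<lambda>k. coef x k - coef y k)"
  unfolding minus_l1_def coef_add coef_minus by simp

lemma coef_sum: "coef (\<Sum>i\<in>I. f i) k = (\<Sum>i\<in>I. coef (f i) k)"
  by (induction I rule: infinite_finite_induct) (simp_all add: coef_0 coef_add)

text \<open>Elements of \<open>l1\<close> act on bounded sequences; this action is applied to
  \<open>\<alpha>\<close> before its summability is known.\<close>

lemma conv_l1_mult:
  assumes "\<And>k. cmod (z k) \<le> Z"
  shows "conv (coef (x * y)) z = conv (coef x) (conv (coef y) z)"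
  unfolding coef_mult by (rule conv_assoc[OF coef_summable coef_summable assms])

lemma conv_l1_diff:
  assumes "\<And>k. cmod (z k) \<le> Z"
  shows "conv (coef (x - y)) z = (\<lambda>k. conv (coef x) z k - conv (coef y) z k)"
proof -
  have "conv (coef (x - y + y)) z = (\<lambda>k. conv (coef (x - y)) z k + conv (coef y) z k)"
    unfolding coef_add by (rule conv_add_left[OF coef_summable coef_summable assms])
  then show ?thesis by (simp add: fun_eq_iff)
qed

subsection \<open>Weighted norms\<close>

text \<open>A bound on the weighted norm is expressed through finite partial sums, so that it passes
  to pointwise limits.\<close>

definition wbound :: "(int \<Rightarrow> real) \<Rightarrow> real \<Rightarrow> (int \<Rightarrow> complex) \<Rightarrow> bool" where
  "wbound v C x \<longleftrightarrow> (\<forall>F. finite F \<longrightarrow> (\<Sum>k\<in>F. cmod (x k) * v k) \<le> C)"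

lemma wboundD: "wbound v C x \<Longrightarrow> finite F \<Longrightarrow> (\<Sum>k\<in>F. cmod (x k) * v k) \<le> C"
  by (simp add: wbound_def)

lemma wbound_nonneg: "wbound v C x \<Longrightarrow> 0 \<le> C"
  using wboundD[of v C x "{}"] by simp

lemma wbound_mono: "wbound v C x \<Longrightarrow> C \<le> D \<Longrightarrow> wbound v D x"
  unfolding wbound_def by force

lemma wbound_weight_mono:
  assumes "wbound v C x" "\<And>k. w k \<le> v k"
  shows "wbound w C x"
  unfolding wbound_def
proof safe
  fix F :: "int set" assume "finite F"
  have "(\<Sum>k\<in>F. cmod (x k) * w k) \<le> (\<Sum>k\<in>F. cmod (x k) * v k)"
    by (intro sum_mono mult_left_mono assms) simp
  also have "\<dots> \<le> C" using wboundD[OF assms(1) \<open>finite F\<close>] .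
  finally show "(\<Sum>k\<in>F. cmod (x k) * w k) \<le> C" .
qed

lemma wbound_add:
  assumes "wbound v C x" "wbound v D y" "\<And>k. 0 \<le> v k"
  shows "wbound v (C + D) (\<lambda>k. x k + y k)"
  unfolding wbound_def
proof safe
  fix F :: "int set" assume "finite F"
  have "(\<Sum>k\<in>F. cmod (x k + y k) * v k) \<le> (\<Sum>k\<in>F. cmod (x k) * v k + cmod (y k) * v k)"
    by (intro sum_mono) (metis assms(3) distrib_right mult_right_mono norm_triangle_ineq)
  also have "\<dots> \<le> C + D"
    using wboundD[OF assms(1) \<open>finite F\<close>] wboundD[OF assms(2) \<open>finite F\<close>]
    by (simp add: sum.distrib)
  finally show "(\<Sum>k\<in>F. cmod (x k + y k) * v k) \<le> C + D" .
qed

lemma wbound_minus: "wbound v C (\<lambda>k. - x k) \<longleftrightarrow> wbound v C x"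
  by (simp add: wbound_def)

lemma wbound_sum:
  assumes "\<And>i. i \<in> I \<Longrightarrow> wbound v (C i) (f i)" "\<And>k. 0 \<le> v k"
  shows "wbound v (\<Sum>i\<in>I. C i) (\<lambda>k. \<Sum>i\<in>I. f i k)"
  using assms(1)
proof (induction I rule: infinite_finite_induct)
  case (insert i I)
  then show ?case using wbound_add[of v "C i" "f i" "sum C I"] assms(2) by simp
qed (simp_all add: wbound_def)

lemma wbound_cmult:
  assumes "wbound v C x"
  shows "wbound v (cmod c * C) (\<lambda>k. c * x k)"
  unfolding wbound_def
proof safe
  fix F :: "int set" assume "finite F"
  have "(\<Sum>k\<in>F. cmod (c * x k) * v k) = cmod c * (\<Sum>k\<in>F. cmod (x k) * v k)"
    by (simp add: norm_mult sum_distrib_left mult.assoc)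
  then show "(\<Sum>k\<in>F. cmod (c * x k) * v k) \<le> cmod c * C"
    using wboundD[OF assms \<open>finite F\<close>] by (simp add: mult_left_mono)
qed

lemma wbound_summable:
  assumes "wbound v C x" "\<And>k. 0 \<le> v k"
  shows "(\<lambda>k. cmod (x k) * v k) summable_on UNIV"
  by (rule nonneg_bdd_above_summable_on)
    (use assms in \<open>auto simp: wbound_def intro!: bdd_aboveI[of _ C]\<close>)

lemma wbound_infsum:
  assumes "wbound v C x" "\<And>k. 0 \<le> v k"
  shows "(\<Sum>\<^sub>\<infinity>k. cmod (x k) * v k) \<le> C"
  by (rule infsum_le_finite_sums[OF wbound_summable[OF assms]]) (use assms in \<open>auto simp: wbound_def\<close>)

lemma summable_imp_wbound:
  assumes "(\<lambda>k. cmod (x k) * v k) summable_on UNIV" "\<And>k. 0 \<le> v k"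
  shows "wbound v (\<Sum>\<^sub>\<infinity>k. cmod (x k) * v k) x"
  unfolding wbound_def using assms by (auto intro!: finite_sum_le_infsum)

lemma wbound_limit:
  assumes "\<And>n. wbound v C (f n)" "\<And>k. (\<lambda>n. f n k) \<longlonglongrightarrow> x k"
  shows "wbound v C x"
  unfolding wbound_def
proof safe
  fix F :: "int set" assume "finite F"
  have "(\<lambda>n. \<Sum>k\<in>F. cmod (f n k) * v k) \<longlonglongrightarrow> (\<Sum>k\<in>F. cmod (x k) * v k)"
    by (intro tendsto_sum tendsto_mult tendsto_norm assms(2) tendsto_const)
  then show "(\<Sum>k\<in>F. cmod (x k) * v k) \<le> C"
    by (rule LIMSEQ_le_const2) (use wboundD[OF assms(1) \<open>finite F\<close>] in blast)
qed

text \<open>A finite set carrying all but \<open>\<epsilon>\<close> of the norm lies in some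
  interval \<open>[-K, K]\<close>, so what is left outside that interval weighs at most
  \<open>\<epsilon>\<close>.\<close>

lemma wbound_tail:
  assumes "wbound v C x" "\<And>k. 0 \<le> v k" "\<epsilon> > 0"
  obtains K :: nat where "wbound v \<epsilon> (\<lambda>k. if \<bar>k\<bar> \<le> int K then 0 else x k)"
proof -
  let ?f = "\<lambda>k. cmod (x k) * v k"
  have s: "?f summable_on UNIV" by (rule wbound_summable[OF assms(1,2)])
  obtain F where F: "finite F" and "dist (sum ?f F) (infsum ?f UNIV) \<le> \<epsilon>"
    using infsum_finite_approximation[OF s assms(3)] by blast
  then have close: "infsum ?f UNIV \<le> sum ?f F + \<epsilon>" by (simp add: dist_real_def abs_le_iff)
  have "finite ((\<lambda>k. nat \<bar>k\<bar>) ` F)" using F by simp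
  then obtain K where K: "\<forall>n\<in>(\<lambda>k. nat \<bar>k\<bar>) ` F. n \<le> K"
    by (meson finite_nat_set_iff_bounded_le)
  have "wbound v \<epsilon> (\<lambda>k. if \<bar>k\<bar> \<le> int K then 0 else x k)"
    unfolding wbound_def
  proof safe
    fix G :: "int set" assume G: "finite G"
    have "sum ?f F + sum ?f (G - F) \<le> infsum ?f UNIV"
      using finite_sum_le_infsum[OF s, of "F \<union> (G - F)"] F G assms(2)
      by (simp add: sum.union_disjoint[symmetric])
    moreover have "(\<Sum>k\<in>G. cmod (if \<bar>k\<bar> \<le> int K then 0 else x k) * v k) \<le> sum ?f (G - F)"
    proof -
      have "(\<Sum>k\<in>G. cmod (if \<bar>k\<bar> \<le> int K then 0 else x k) * v k)
          = (\<Sum>k\<in>G - F. cmod (if \<bar>k\<bar> \<le> int K then 0 else x k) * v k)"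
        using K G by (intro sum.mono_neutral_right) auto
      also have "\<dots> \<le> sum ?f (G - F)"
        using assms(2) by (intro sum_mono) auto
      finally show ?thesis .
    qed
    ultimately show "(\<Sum>k\<in>G. cmod (if \<bar>k\<bar> \<le> int K then 0 else x k) * v k) \<le> \<epsilon>"
      using close by linarith
  qed
  then show ?thesis by (rule that)
qed

lemma has_sum_sum:
  fixes f :: "'i \<Rightarrow> 'a \<Rightarrow> real"
  assumes "\<And>i. i \<in> I \<Longrightarrow> (f i has_sum s i) A"
  shows "((\<lambda>l. \<Sum>i\<in>I. f i l) has_sum (\<Sum>i\<in>I. s i)) A"
  using assms by (induction I rule: infinite_finite_induct) (auto intro: has_sum_add)

text \<open>Submultiplicativity splits \<open>v k\<close> between the factors at
  \<open>k - l\<close> and \<open>l\<close>; the sum over the finite set \<open>F\<close> is then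
  moved inside the sum over \<open>l\<close>. The bound \<open>1 \<le> v\<close> makes both factors
  absolutely summable, so that \<open>conv\<close> is a genuine series.\<close>

lemma wbound_conv:
  assumes x: "wbound v C x" and y: "wbound v D y"
    and v1: "\<And>k. 1 \<le> v k" and sub: "\<And>k l. v (k + l) \<le> v k * v l"
  shows "wbound v (C * D) (conv x y)"
  unfolding wbound_def
proof safe
  fix F :: "int set" assume F: "finite F"
  have v0: "0 \<le> v k" for k using v1[of k] by linarith
  have C0: "0 \<le> C" using wbound_nonneg[OF x] .
  have xs: "x abs_summable_on UNIV" and ys: "y abs_summable_on UNIV"
    using wbound_summable[OF wbound_weight_mono[OF x, of "\<lambda>_. 1"]] 
      wbound_summable[OF wbound_weight_mono[OF y, of "\<lambda>_. 1"]] v1 by simp_all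
  have ysv: "(\<lambda>l. cmod (y l) * v l) summable_on UNIV"
    by (rule wbound_summable[OF y v0])
  \<comment> \<open>Translates of a finite set are finite, so the bound for \<open>x\<close> is
    uniform in \<open>l\<close>.\<close>
  have bnd: "(\<Sum>k\<in>F. cmod (x (k - l)) * v (k - l)) \<le> C" for l
  proof -
    have "(\<Sum>k\<in>F. cmod (x (k - l)) * v (k - l)) = (\<Sum>k\<in>(\<lambda>k. k - l) ` F. cmod (x k) * v k)"
      by (subst sum.reindex) (auto simp: inj_on_def)
    also have "\<dots> \<le> C" using F by (intro wboundD[OF x]) simp
    finally show ?thesis .
  qed
  have each: "(\<lambda>l. (cmod (x (k - l)) * v (k - l)) * (cmod (y l) * v l)) summable_on UNIV"
    if "k \<in> F" for k
  proof -
    have "(\<lambda>l. norm ((cmod (x (k - l)) * v (k - l)) * (cmod (y l) * v l))) summable_on UNIV"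
    proof (rule Infinite_Sum.abs_summable_on_comparison_test'[OF summable_on_cmult_right[OF ysv, of C]])
      fix l
      have "cmod (x (k - l)) * v (k - l) \<le> C"
        using wboundD[OF x, of "{k - l}"] by simp
      then show "norm ((cmod (x (k - l)) * v (k - l)) * (cmod (y l) * v l))
          \<le> C * (cmod (y l) * v l)"
        by (simp add: abs_mult v0 mult_right_mono)
    qed
    then show ?thesis by (simp add: abs_mult v0)
  qed
  have "(\<Sum>k\<in>F. cmod (conv x y k) * v k)
      \<le> (\<Sum>k\<in>F. \<Sum>\<^sub>\<infinity>l. (cmod (x (k - l)) * v (k - l)) * (cmod (y l) * v l))"
  proof (rule sum_mono)
    fix k assume k: "k \<in> F"
    note s = abs_summable_conv_kernel[OF xs abs_summable_imp_bounded[OF ys], of k]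
    have "cmod (conv x y k) * v k \<le> (\<Sum>\<^sub>\<infinity>l. cmod (x (k - l) * y l)) * v k"
      unfolding conv_def by (rule mult_right_mono[OF norm_infsum_bound[OF s] v0])
    also have "\<dots> = (\<Sum>\<^sub>\<infinity>l. cmod (x (k - l) * y l) * v k)"
      by (simp add: infsum_cmult_left')
    also have "\<dots> \<le> (\<Sum>\<^sub>\<infinity>l. (cmod (x (k - l)) * v (k - l)) * (cmod (y l) * v l))"
    proof (rule infsum_mono[OF summable_on_cmult_left[OF s] each[OF k]])
      fix l
      have "v k \<le> v (k - l) * v l" using sub[of "k - l" l] by simp
      then have "(cmod (x (k - l)) * cmod (y l)) * v k
          \<le> (cmod (x (k - l)) * cmod (y l)) * (v (k - l) * v l)"
        by (intro mult_left_mono) auto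
      then show "cmod (x (k - l) * y l) * v k
          \<le> (cmod (x (k - l)) * v (k - l)) * (cmod (y l) * v l)"
        by (simp add: norm_mult algebra_simps)
    qed
    finally show "cmod (conv x y k) * v k
        \<le> (\<Sum>\<^sub>\<infinity>l. (cmod (x (k - l)) * v (k - l)) * (cmod (y l) * v l))" .
  qed
  also have "\<dots> = (\<Sum>\<^sub>\<infinity>l. \<Sum>k\<in>F. (cmod (x (k - l)) * v (k - l)) * (cmod (y l) * v l))"
    by (rule infsumI[symmetric], rule has_sum_sum, rule has_sum_infsum, rule each)
  also have "\<dots> \<le> (\<Sum>\<^sub>\<infinity>l. C * (cmod (y l) * v l))"
  proof (rule infsum_mono)
    show "(\<lambda>l. \<Sum>k\<in>F. (cmod (x (k - l)) * v (k - l)) * (cmod (y l) * v l)) summable_on UNIV"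
      by (rule has_sum_imp_summable[OF has_sum_sum[OF has_sum_infsum[OF each]]])
    show "(\<lambda>l. C * (cmod (y l) * v l)) summable_on UNIV"
      by (rule summable_on_cmult_right[OF ysv])
    show "(\<Sum>k\<in>F. (cmod (x (k - l)) * v (k - l)) * (cmod (y l) * v l)) \<le> C * (cmod (y l) * v l)" for l
      using mult_right_mono[OF bnd[of l], of "cmod (y l) * v l"] v0[of l]
      by (simp add: sum_distrib_right)
  qed
  also have "\<dots> \<le> C * D"
    using wbound_infsum[OF y v0] C0 by (simp add: infsum_cmult_right' mult_left_mono)
  finally show "(\<Sum>k\<in>F. cmod (conv x y k) * v k) \<le> C * D" .
qed

lemma wbound_one:
  assumes "0 \<le> v 0"
  shows "wbound v (v 0) (coef 1)"
  unfolding wbound_def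
proof safe
  fix F :: "int set" assume "finite F"
  then have "(\<Sum>k\<in>F. cmod (coef 1 k) * v k) = (\<Sum>k\<in>F \<inter> {0}. cmod (coef 1 k) * v k)"
    by (intro sum.mono_neutral_right) (auto simp: coef_1 indicator_def)
  also have "\<dots> \<le> v 0"
    using assms by (cases "0 \<in> F") (auto simp: coef_1)
  finally show "(\<Sum>k\<in>F. cmod (coef 1 k) * v k) \<le> v 0" .
qed

lemma wbound_power:
  assumes "wbound (\<lambda>_. 1) C (coef x)"
  shows "wbound (\<lambda>_. 1) (C ^ n) (coef (x ^ n))"
proof (induction n)
  case 0
  show ?case using wbound_one[of "\<lambda>_. 1"] by simp
next
  case (Suc n)
  then show ?case using wbound_conv[OF assms Suc] by (simp add: coef_mult)
qed

subsection \<open>Positive definite operators on square-summable sequences\<close>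

text \<open>The inner product of \<open>ell2\<close> viewed as a real Hilbert space: it is
  symmetric, and the expansions below use real scalars only, so no conjugates appear.\<close>

definition rinner :: "(int \<Rightarrow> complex) \<Rightarrow> (int \<Rightarrow> complex) \<Rightarrow> real" where
  "rinner x y = (\<Sum>\<^sub>\<infinity>k. Re (x k * cnj (y k)))"

lemma ell2_inner_summable:
  assumes "x \<in> ell2" "y \<in> ell2"
  shows "(\<lambda>k. x k * cnj (y k)) summable_on UNIV"
proof (rule abs_summable_summable, rule Infinite_Sum.abs_summable_on_comparison_test')
  show "(\<lambda>k. (cmod (x k))\<^sup>2 + (cmod (y k))\<^sup>2) summable_on UNIV"
    using assms by (intro summable_on_add) (simp_all add: ell2_def)
  show "norm (x k * cnj (y k)) \<le> (cmod (x k))\<^sup>2 + (cmod (y k))\<^sup>2" for k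
    using sum_squares_bound[of "cmod (x k)" "cmod (y k)"]
      mult_nonneg_nonneg[OF norm_ge_zero norm_ge_zero, of "x k" "y k"]
    unfolding norm_mult complex_mod_cnj by linarith
qed

lemma Re_ell2_inner:
  assumes "x \<in> ell2" "y \<in> ell2"
  shows "Re (ell2_inner x y) = rinner x y"
  using infsum_Re[OF ell2_inner_summable[OF assms]] by (simp add: ell2_inner_def rinner_def)

lemma rinner_summable:
  assumes "x \<in> ell2" "y \<in> ell2"
  shows "(\<lambda>k. Re (x k * cnj (y k))) summable_on UNIV"
  by (rule summable_on_Re[OF ell2_inner_summable[OF assms]])

lemma ell2_scale:
  assumes "x \<in> ell2"
  shows "(\<lambda>k. c * x k) \<in> ell2"
  using summable_on_cmult_right[of "\<lambda>k. (cmod (x k))\<^sup>2" UNIV "(cmod c)\<^sup>2"] assms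
  by (simp add: ell2_def norm_mult power_mult_distrib)

lemma ell2_add:
  assumes "x \<in> ell2" "y \<in> ell2"
  shows "(\<lambda>k. x k + y k) \<in> ell2"
proof -
  have "(\<lambda>k. norm ((cmod (x k + y k))\<^sup>2)) summable_on UNIV"
  proof (rule Infinite_Sum.abs_summable_on_comparison_test')
    show "(\<lambda>k. 2 * (cmod (x k))\<^sup>2 + 2 * (cmod (y k))\<^sup>2) summable_on UNIV"
      using assms by (intro summable_on_add summable_on_cmult_right) (simp_all add: ell2_def)
    fix k
    have "(cmod (x k + y k))\<^sup>2 \<le> (cmod (x k) + cmod (y k))\<^sup>2"
      by (simp add: norm_triangle_ineq power_mono)
    also have "\<dots> \<le> 2 * (cmod (x k))\<^sup>2 + 2 * (cmod (y k))\<^sup>2"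
      using sum_squares_bound[of "cmod (x k)" "cmod (y k)"] by (simp add: power2_sum)
    finally show "norm ((cmod (x k + y k))\<^sup>2) \<le> 2 * (cmod (x k))\<^sup>2 + 2 * (cmod (y k))\<^sup>2"
      by simp
  qed
  then show ?thesis by (simp add: ell2_def)
qed

lemma rinner_commute: "rinner x y = rinner y x"
  by (simp add: rinner_def mult.commute)

lemma rinner_add_scale:
  fixes t :: real
  assumes "x \<in> ell2" "y \<in> ell2" "z \<in> ell2"
  shows "rinner (\<lambda>k. x k + complex_of_real t * y k) z = rinner x z + t * rinner y z"
proof -
  have "rinner (\<lambda>k. x k + complex_of_real t * y k) z = (\<Sum>\<^sub>\<infinity>k. Re (x k * cnj (z k)) + t * Re (y k * cnj (z k)))"
    by (simp add: rinner_def algebra_simps)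
  also have "\<dots> = rinner x z + t * rinner y z"
    by (subst infsum_add) (simp_all add: rinner_def rinner_summable assms summable_on_cmult_right
        infsum_cmult_right' del: times_complex.sel)
  finally show ?thesis .
qed

lemma rinner_self: "rinner x x = (\<Sum>\<^sub>\<infinity>k. (cmod (x k))\<^sup>2)"
  by (simp add: rinner_def complex_mult_cnj cmod_power2 flip: complex_norm_square)

lemma rinner_self_nonneg: "0 \<le> rinner x x"
  by (simp add: rinner_self infsum_nonneg)

lemma ell2_norm_eq: "ell2_norm x = sqrt (rinner x x)"
  by (simp add: rinner_self ell2_norm_def)

lemma rinner_self_add_scale:
  fixes t :: real
  assumes "x \<in> ell2" "y \<in> ell2"
  shows "rinner (\<lambda>k. x k + complex_of_real t * y k) (\<lambda>k. x k + complex_of_real t * y k)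
    = rinner x x + 2 * t * rinner y x + t\<^sup>2 * rinner y y"
proof -
  let ?z = "\<lambda>k. x k + complex_of_real t * y k"
  have z: "?z \<in> ell2" by (rule ell2_add[OF assms(1) ell2_scale[OF assms(2)]])
  have "rinner ?z ?z = rinner ?z x + t * rinner ?z y"
    using rinner_add_scale[OF assms z] by (simp add: rinner_commute)
  also have "\<dots> = rinner x x + 2 * t * rinner y x + t\<^sup>2 * rinner y y"
    by (simp add: rinner_add_scale assms rinner_commute[of x y] power2_eq_square algebra_simps)
  finally show ?thesis .
qed

lemma ell2_norm_bound_sq:
  assumes "\<forall>x\<in>ell2. ell2_norm (T x) \<le> C * ell2_norm x" "C \<le> M" "x \<in> ell2"
  shows "rinner (T x) (T x) \<le> M\<^sup>2 * rinner x x"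
proof -
  have "ell2_norm (T x) \<le> M * ell2_norm x"
    using assms mult_right_mono[OF assms(2), of "ell2_norm x"]
    by (force simp: ell2_norm_eq rinner_self_nonneg)
  then have "(ell2_norm (T x))\<^sup>2 \<le> (M * ell2_norm x)\<^sup>2"
    by (intro power_mono) (simp_all add: ell2_norm_eq rinner_self_nonneg)
  then show ?thesis
    by (simp add: ell2_norm_eq rinner_self_nonneg power_mult_distrib)
qed

definition damped :: "(int \<Rightarrow> int \<Rightarrow> complex) \<Rightarrow> real \<Rightarrow> (int \<Rightarrow> complex) \<Rightarrow> int \<Rightarrow> complex" where
  "damped A M x = (\<lambda>k. x k - complex_of_real (1 / M) * matrix_operator A x k)"

text \<open>Positivity tested on \<open>x - T x / M\<close> gives \<open>\<langle>T x, x\<rangle> \<ge> \<parallel>T x\<parallel>\<^sup>2 / M\<close>, and bounded invertibility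
  bounds \<open>\<parallel>T x\<parallel>\<close> from below.\<close>

lemma hermitian_positive_definite_contraction:
  assumes "hermitian_positive_definite A"
  obtains M r :: real where "0 \<le> r" "r < 1"
    "\<forall>x\<in>ell2. damped A M x \<in> ell2 \<and> rinner (damped A M x) (damped A M x) \<le> r\<^sup>2 * rinner x x"
proof -
  define T where "T = matrix_operator A"
  have bi: "ell2_boundedly_invertible T" and bm: "ell2_bounded_operator T"
    using assms by (simp_all add: hermitian_positive_definite_def ell2_bounded_matrix_def T_def)
  have sym: "ell2_inner (T x) y = ell2_inner x (T y)" if "x \<in> ell2" "y \<in> ell2" for x y
    using assms that by (simp add: hermitian_positive_definite_def T_def)
  have pos: "0 \<le> Re (ell2_inner (T x) x)" if "x \<in> ell2" for x
    using assms that unfolding hermitian_positive_definite_def T_def by blast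
  have Tmem: "T x \<in> ell2" and Tscale: "T (\<lambda>k. c * x k) = (\<lambda>k. c * T x k)"
    if "x \<in> ell2" for x c
    using bm that by (simp_all add: ell2_bounded_operator_def)
  have Tadd: "T (\<lambda>k. x k + y k) = (\<lambda>k. T x k + T y k)" if "x \<in> ell2" "y \<in> ell2" for x y
    using bm that by (simp add: ell2_bounded_operator_def)
  obtain C where C: "\<forall>x\<in>ell2. ell2_norm (T x) \<le> C * ell2_norm x"
    using bm unfolding ell2_bounded_operator_def by blast
  obtain S where Sb: "ell2_bounded_operator S" and S: "\<And>x. x \<in> ell2 \<Longrightarrow> S (T x) = x"
    using bi unfolding ell2_boundedly_invertible_def by blast
  obtain D where D: "\<forall>x\<in>ell2. ell2_norm (S x) \<le> D * ell2_norm x"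
    using Sb unfolding ell2_bounded_operator_def by blast
  \<comment> \<open>Adding 1 to the modulus keeps \<open>M\<close> and \<open>E\<close> at least 1
    whatever the given operator bounds are, so division by them is safe.\<close>
  define M where "M = \<bar>C\<bar> + 1"
  define E where "E = \<bar>D\<bar> + 1"
  have M: "1 \<le> M" "C \<le> M" and E: "1 \<le> E" "D \<le> E" by (simp_all add: M_def E_def)
  define t where "t = - (1 / M)"
  define z where "z x = (\<lambda>k. x k + complex_of_real t * T x k)" for x
  have zmem: "z x \<in> ell2" if "x \<in> ell2" for x
    unfolding z_def by (rule ell2_add[OF that ell2_scale[OF Tmem[OF that]]])
  have TM: "rinner (T x) (T x) \<le> M\<^sup>2 * rinner x x" if "x \<in> ell2" for x
    by (rule ell2_norm_bound_sq[OF C M(2) that])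
  have low: "rinner x x \<le> E\<^sup>2 * rinner (T x) (T x)" if "x \<in> ell2" for x
    using ell2_norm_bound_sq[OF D E(2) Tmem[OF that]] S[OF that] by simp
  have key: "rinner (T x) (T x) / M \<le> rinner (T x) x" if x: "x \<in> ell2" for x
  proof -
    define y where "y = T x"
    define w where "w = T y"
    have y: "y \<in> ell2" and w: "w \<in> ell2" using x by (simp_all add: y_def w_def Tmem)
    have "T (z x) = (\<lambda>k. y k + complex_of_real t * w k)"
      by (simp add: z_def y_def w_def Tadd Tscale x y ell2_scale Tmem)
    then have "rinner (T (z x)) (z x) = rinner y (z x) + t * rinner w (z x)"
      using y w zmem[OF x] by (simp add: rinner_add_scale)
    also have "rinner y (z x) = rinner y x + t * rinner y y"
      using rinner_add_scale[OF x y y, of t] by (simp add: z_def y_def rinner_commute)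
    also have "rinner w (z x) = rinner w x + t * rinner w y"
      using rinner_add_scale[OF x y w, of t] by (simp add: z_def y_def rinner_commute)
    also have "rinner w x = rinner y y"
      using sym[OF y x] Re_ell2_inner[OF w x] Re_ell2_inner[OF y y] by (simp add: w_def y_def)
    finally have "rinner (T (z x)) (z x)
        = rinner y x + 2 * t * rinner y y + t\<^sup>2 * rinner w y"
      by (simp add: power2_eq_square algebra_simps)
    moreover have "0 \<le> rinner (T (z x)) (z x)"
      using pos[OF zmem[OF x]] Re_ell2_inner[OF Tmem[OF zmem[OF x]] zmem[OF x]] by simp
    \<comment> \<open>Expanding the nonnegative square norm of \<open>w - M y\<close> and using
      \<open>\<parallel>w\<parallel> \<le> M \<parallel>y\<parallel>\<close> takes the place of
      Cauchy-Schwarz.\<close>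
    moreover have "rinner w y \<le> M * rinner y y"
    proof -
      have "0 \<le> rinner w w + 2 * (- M) * rinner y w + (- M)\<^sup>2 * rinner y y"
        using rinner_self_nonneg[of "\<lambda>k. w k + complex_of_real (- M) * y k"]
        unfolding rinner_self_add_scale[OF w y] .
      then have "2 * M * rinner w y \<le> 2 * M * (M * rinner y y)"
        using TM[OF y] by (simp add: w_def[symmetric] rinner_commute[of y w] power2_eq_square)
      then show ?thesis using M(1) by simp
    qed
    then have "t\<^sup>2 * rinner w y \<le> t\<^sup>2 * (M * rinner y y)"
      by (intro mult_left_mono) auto
    moreover have "t\<^sup>2 * (M * rinner y y) = rinner y y / M"
      using M(1) by (simp add: t_def power2_eq_square field_simps)
    ultimately show ?thesis
      by (simp add: t_def y_def)
  qed
  \<comment> \<open>The estimate below reaches \<open>\<parallel>x\<parallel>\<^sup>2 - \<parallel>T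
    x\<parallel>\<^sup>2 / M\<^sup>2\<close>, and
    \<open>\<parallel>T x\<parallel> \<ge> \<parallel>x\<parallel> / E\<close> turns this into the
    factor under the root.\<close>
  define r where "r = sqrt (1 - 1 / (M\<^sup>2 * E\<^sup>2))"
  have ME: "1 \<le> M\<^sup>2 * E\<^sup>2"
    using M(1) E(1) by (simp add: one_le_power mult_ge1_I)
  have r2: "r\<^sup>2 = 1 - 1 / (M\<^sup>2 * E\<^sup>2)"
    using ME by (simp add: r_def divide_le_eq_1)
  have z_eq: "damped A M x = z x" for x
    by (simp add: damped_def z_def t_def T_def)
  show ?thesis
  proof (rule that[of r M], unfold z_eq, safe)
    show "0 \<le> r" using ME by (simp add: r_def divide_le_eq_1)
    show "r < 1" using ME by (simp add: r_def)
    fix x assume x: "x \<in> ell2"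
    show "z x \<in> ell2" by (rule zmem[OF x])
    have "rinner (z x) (z x) = rinner x x + 2 * t * rinner (T x) x + t\<^sup>2 * rinner (T x) (T x)"
      unfolding z_def by (rule rinner_self_add_scale[OF x Tmem[OF x]])
    also have "\<dots> \<le> rinner x x + 2 * t * (rinner (T x) (T x) / M) + t\<^sup>2 * rinner (T x) (T x)"
      using mult_left_mono[OF key[OF x], of "1 / M"] M(1) by (simp add: t_def)
    also have "\<dots> = rinner x x - rinner (T x) (T x) / M\<^sup>2"
      by (simp add: t_def power2_eq_square)
    also have "\<dots> \<le> rinner x x - (rinner x x / E\<^sup>2) / M\<^sup>2"
      using low[OF x] E(1) by (intro diff_mono divide_right_mono) (auto simp: divide_le_eq mult.commute)
    also have "\<dots> = r\<^sup>2 * rinner x x"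
      by (simp add: r2 algebra_simps)
    finally show "rinner (z x) (z x) \<le> r\<^sup>2 * rinner x x" .
  qed
qed

subsection \<open>The spectral radius in weighted norms\<close>

text \<open>Bounding finite sections lets the triangle inequality for \<open>L2_set\<close> carry
  over and keeps membership in \<open>ell2\<close> out of the inductions on powers.\<close>

definition l2bound :: "real \<Rightarrow> (int \<Rightarrow> complex) \<Rightarrow> bool" where
  "l2bound C x \<longleftrightarrow> (\<forall>F. finite F \<longrightarrow> L2_set (\<lambda>k. cmod (x k)) F \<le> C)"

lemma l2bound_diff:
  assumes "l2bound C x" "l2bound D y"
  shows "l2bound (C + D) (\<lambda>k. x k - y k)"
  unfolding l2bound_def
proof safe
  fix F :: "int set" assume "finite F"
  have "L2_set (\<lambda>k. cmod (x k - y k)) F \<le> L2_set (\<lambda>k. cmod (x k) + cmod (y k)) F"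
    by (intro L2_set_mono) (auto simp: norm_triangle_ineq4)
  also have "\<dots> \<le> L2_set (\<lambda>k. cmod (x k)) F + L2_set (\<lambda>k. cmod (y k)) F"
    by (rule L2_set_triangle_ineq)
  also have "\<dots> \<le> C + D"
    using assms \<open>finite F\<close> by (auto simp: l2bound_def intro!: add_mono)
  finally show "L2_set (\<lambda>k. cmod (x k - y k)) F \<le> C + D" .
qed

lemma wbound_imp_l2bound:
  assumes "wbound (\<lambda>_. 1) C x"
  shows "l2bound C x"
  unfolding l2bound_def
proof safe
  fix F :: "int set" assume "finite F"
  then show "L2_set (\<lambda>k. cmod (x k)) F \<le> C"
    using L2_set_le_sum[of F "\<lambda>k. cmod (x k)"] wboundD[OF assms, of F] by simp
qed

lemma l2bound_pointwise: "l2bound C x \<Longrightarrow> cmod (x k) \<le> C"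
  unfolding l2bound_def by (drule spec[of _ "{k}"]) simp

lemma l2bound_iff_ell2:
  assumes "0 \<le> C"
  shows "l2bound C x \<longleftrightarrow> x \<in> ell2 \<and> rinner x x \<le> C\<^sup>2"
proof -
  have *: "L2_set (\<lambda>k. cmod (x k)) F \<le> C \<longleftrightarrow> (\<Sum>k\<in>F. (cmod (x k))\<^sup>2) \<le> C\<^sup>2" for F
    unfolding L2_set_def using assms by (metis real_sqrt_le_iff real_sqrt_abs abs_of_nonneg)
  show ?thesis
  proof safe
    assume "l2bound C x"
    then have F: "(\<Sum>k\<in>F. (cmod (x k))\<^sup>2) \<le> C\<^sup>2" if "finite F" for F
      using that by (simp add: l2bound_def *)
    have "(\<lambda>k. (cmod (x k))\<^sup>2) summable_on UNIV"
      by (rule nonneg_bdd_above_summable_on) (use F in \<open>auto intro!: bdd_aboveI[of _ "C\<^sup>2"]\<close>)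
    then show "x \<in> ell2" and "rinner x x \<le> C\<^sup>2"
      using F by (auto simp: ell2_def rinner_self intro!: infsum_le_finite_sums)
  next
    assume x: "x \<in> ell2" "rinner x x \<le> C\<^sup>2"
    show "l2bound C x"
      unfolding l2bound_def *
    proof safe
      fix F :: "int set" assume "finite F"
      then have "(\<Sum>k\<in>F. (cmod (x k))\<^sup>2) \<le> (\<Sum>\<^sub>\<infinity>k. (cmod (x k))\<^sup>2)"
        using x(1) by (intro finite_sum_le_infsum) (auto simp: ell2_def)
      then show "(\<Sum>k\<in>F. (cmod (x k))\<^sup>2) \<le> C\<^sup>2"
        using x(2) by (simp add: rinner_self)
    qed
  qed
qed

text \<open>Trading factors \<open>p\<close> for \<open>b\<close> and \<open>q\<close> one at a time replaces a binomial expansion.\<close>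

lemma l2bound_power_perturb:
  assumes b: "\<And>C x. l2bound C x \<Longrightarrow> l2bound (r * C) (conv (coef b) x)"
    and q: "wbound (\<lambda>_. 1) \<epsilon> (coef q)" and p: "p = b - q"
  shows "l2bound ((r + \<epsilon>) ^ m) (coef (p ^ m))"
proof -
  \<comment> \<open>The \<open>ell2\<close> norm of \<open>q ^ l\<close> is at most its unweighted
    summable norm, hence at most \<open>\<epsilon> ^ l\<close>; each convolution with
    \<open>b\<close> then costs a factor \<open>r\<close>.\<close>
  have base: "l2bound (r ^ n * \<epsilon> ^ l) (coef (b ^ n * q ^ l))" for n l
  proof (induction n)
    case 0
    then show ?case using wbound_imp_l2bound[OF wbound_power[OF q]] by simp
  next
    case (Suc n)
    from b[OF this] show ?case by (simp add: coef_mult[symmetric] mult.assoc)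
  qed
  have "l2bound ((r + \<epsilon>) ^ m * (r ^ n * \<epsilon> ^ l)) (coef (p ^ m * (b ^ n * q ^ l)))" for n l
  proof (induction m arbitrary: n l)
    case 0
    then show ?case using base by simp
  next
    case (Suc m)
    have "p ^ Suc m * (b ^ n * q ^ l)
        = p ^ m * (b ^ Suc n * q ^ l) - p ^ m * (b ^ n * q ^ Suc l)"
      by (simp add: p algebra_simps)
    then have "coef (p ^ Suc m * (b ^ n * q ^ l)) = (\<lambda>k. coef (p ^ m * (b ^ Suc n * q ^ l)) k
        - coef (p ^ m * (b ^ n * q ^ Suc l)) k)"
      by (simp only: coef_diff)
    moreover have "(r + \<epsilon>) ^ Suc m * (r ^ n * \<epsilon> ^ l)
        = (r + \<epsilon>) ^ m * (r ^ Suc n * \<epsilon> ^ l) + (r + \<epsilon>) ^ m * (r ^ n * \<epsilon> ^ Suc l)"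
      by (simp add: algebra_simps)
    ultimately show ?case
      using l2bound_diff[OF Suc[of "Suc n" l] Suc[of n "Suc l"]] by (simp only:)
  qed
  from this[of 0 0] show ?thesis by simp
qed

text \<open>Supports add under convolution: if \<open>\<bar>k\<bar>\<close> exceeds
  \<open>K + m K\<close>, then \<open>k - l\<close> is beyond \<open>K\<close> or \<open>l\<close>
  is beyond \<open>m K\<close>.\<close>

lemma coef_power_support:
  assumes "\<And>k. int K < \<bar>k\<bar> \<Longrightarrow> coef p k = 0" "int (m * K) < \<bar>k\<bar>"
  shows "coef (p ^ m) k = 0"
  using assms(2)
proof (induction m arbitrary: k)
  case 0
  then show ?case by (simp add: coef_1)
next
  case (Suc m)
  have "coef p (k - l) * coef (p ^ m) l = 0" for l
  proof (cases "int K < \<bar>k - l\<bar>")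
    case False
    then have "int (m * K) < \<bar>l\<bar>" using Suc.prems by simp
    then show ?thesis using Suc.IH by simp
  qed (simp add: assms(1))
  then show ?case unfolding power_Suc coef_mult conv_def by (simp only: infsum_0_simp)
qed

text \<open>The two root limits are the Gelfand-Raikov-Shilov condition, stated in both directions
  because \<open>v\<close> need not be even.\<close>

locale grs_weight =
  fixes v :: "int \<Rightarrow> real"
  assumes pos: "0 < v k"
    and submult: "v (k + l) \<le> v k * v l"
    and root_pos: "(\<lambda>n. root n (v (int n))) \<longlonglongrightarrow> 1"
    and root_neg: "(\<lambda>n. root n (v (- int n))) \<longlonglongrightarrow> 1"
begin

text \<open>The exponent starts at 1, since exponent 0 would assert \<open>v 0 \<le> 1\<close>,
  which can fail.\<close>

lemma power_le: "v (int (Suc n) * k) \<le> v k ^ Suc n"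
proof (induction n)
  case (Suc n)
  have "v (int (Suc (Suc n)) * k) = v (k + int (Suc n) * k)"
    by (simp add: algebra_simps)
  also have "\<dots> \<le> v k * v (int (Suc n) * k)" by (rule submult)
  also have "\<dots> \<le> v k * v k ^ Suc n"
    using Suc pos[of k] by (intro mult_left_mono) auto
  finally show ?case by simp
qed simp

text \<open>Put \<open>m = \<bar>k\<bar>\<close> and take the \<open>n m\<close>-th root of
  \<open>v (n k) \<le> v k ^ n\<close>: the right side becomes the \<open>m\<close>-th root of
  \<open>v k\<close>, while the left side tends to 1 along the multiples of \<open>m\<close>. For
  \<open>k = 0\<close> use \<open>v 0 \<le> v 0 * v 0\<close>.\<close>

lemma ge1: "1 \<le> v k"
proof (cases "k = 0")
  case True
  then show ?thesis using submult[of 0 0] pos[of 0] by simp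
next
  case False
  define m where "m = nat \<bar>k\<bar>"
  define s where "s n = root n (if 0 < k then v (int n) else v (- int n))" for n
  have m: "0 < m" using False by (simp add: m_def)
  have s: "s \<longlonglongrightarrow> 1"
    using root_pos root_neg by (cases "0 < k") (simp_all add: s_def[abs_def])
  have "strict_mono (\<lambda>n. Suc n * m)"
    using m by (auto simp: strict_mono_def)
  from LIMSEQ_subseq_LIMSEQ[OF s this] have "(\<lambda>n. s (Suc n * m)) \<longlonglongrightarrow> 1"
    by (simp add: o_def)
  moreover have "s (Suc n * m) \<le> root m (v k)" for n
  proof -
    have "s (Suc n * m) = root (Suc n * m) (v (int (Suc n) * k))"
      using False by (auto simp: s_def m_def algebra_simps)
    also have "\<dots> \<le> root (Suc n * m) (v k ^ Suc n)"
      using m by (intro real_root_le_mono power_le) simp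
    also have "\<dots> = root m (v k)"
      using m pos[of k] real_root_power_cancel[of "Suc n" "v k"]
      by (simp only: mult.commute[of "Suc n"] real_root_mult_exp)
    finally show ?thesis .
  qed
  ultimately have "1 \<le> root m (v k)"
    by (intro LIMSEQ_le_const2) auto
  then show ?thesis using m by simp
qed

lemma nonneg: "0 \<le> v k"
  using pos[of k] by simp

lemma subexponential:
  assumes "1 < t"
  obtains C where "0 < C" "\<And>k. v k \<le> C * t ^ nat \<bar>k\<bar>"
proof -
  have ev: "\<exists>N. \<forall>n\<ge>N. w n \<le> t ^ n" if "(\<lambda>n. root n (w n)) \<longlonglongrightarrow> 1" "\<And>n. 0 \<le> w n"
    for w :: "nat \<Rightarrow> real"
  proof -
    have "eventually (\<lambda>n. root n (w n) < t) sequentially"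
      by (rule order_tendstoD(2)[OF that(1) assms])
    with eventually_gt_at_top[of "0::nat"] have "eventually (\<lambda>n. w n \<le> t ^ n) sequentially"
    proof eventually_elim
      case (elim n)
      then have "root n (w n) ^ n \<le> t ^ n" using that(2) by (intro power_mono) auto
      then show ?case using elim that(2) by simp
    qed
    then show ?thesis by (simp add: eventually_sequentially)
  qed
  obtain N1 where N1: "\<And>n. N1 \<le> n \<Longrightarrow> v (int n) \<le> t ^ n"
    using ev[OF root_pos nonneg] by blast
  obtain N2 where N2: "\<And>n. N2 \<le> n \<Longrightarrow> v (- int n) \<le> t ^ n"
    using ev[OF root_neg nonneg] by blast
  define R where "R = int (N1 + N2)"
  \<comment> \<open>The sum absorbs the finitely many exceptional indices; the summand 1 gives
    \<open>C \<ge> 1\<close>, so the same constant serves beyond \<open>R\<close>.\<close>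
  define C where "C = 1 + (\<Sum>k\<in>{-R..R}. v k)"
  have C1: "1 \<le> C" unfolding C_def by (simp add: sum_nonneg nonneg)
  have "v k \<le> C * t ^ nat \<bar>k\<bar>" for k
  proof (cases "\<bar>k\<bar> \<le> R")
    case True
    then have "v k \<le> (\<Sum>k\<in>{-R..R}. v k)"
      by (intro member_le_sum) (auto simp: nonneg)
    then have "v k \<le> C" by (simp add: C_def)
    also have "\<dots> \<le> C * t ^ nat \<bar>k\<bar>"
      using C1 assms by (simp add: one_le_power)
    finally show ?thesis .
  next
    case False
    have "v k \<le> t ^ nat \<bar>k\<bar>"
      using N1[of "nat \<bar>k\<bar>"] N2[of "nat \<bar>k\<bar>"] False by (cases "0 \<le> k") (auto simp: R_def)
    also have "\<dots> \<le> C * t ^ nat \<bar>k\<bar>"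
      using C1 assms by simp
    finally show ?thesis .
  qed
  then show ?thesis using C1 by (intro that[of C]) auto
qed

text \<open>The power \<open>p ^ m\<close> lives on \<open>2 m K + 1\<close> points, has entries at
  most \<open>s ^ m\<close> there, and meets weights at most \<open>C * t ^ (m K)\<close>. With
  \<open>t\<close> close to 1 the exponential rate stays below \<open>\<rho>\<close>, and the linear
  factor is absorbed by the remaining gap.\<close>

lemma wbound_power_finite_support:
  assumes supp: "\<And>k. int K < \<bar>k\<bar> \<Longrightarrow> coef p k = 0"
    and l2: "\<And>m. l2bound (s ^ m) (coef (p ^ m))" and "0 < s" "s < \<rho>"
  obtains C where "0 \<le> C" "\<And>m. wbound v (C * \<rho> ^ m) (coef (p ^ m))"
proof -
  define \<sigma> where "\<sigma> = (s + \<rho>) / 2"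
  have \<sigma>: "s < \<sigma>" "\<sigma> < \<rho>" using assms by (simp_all add: \<sigma>_def)
  \<comment> \<open>The order \<open>Suc K\<close> also covers \<open>K = 0\<close> and still gives
    \<open>t ^ K * s \<le> \<sigma>\<close>.\<close>
  define t where "t = root (Suc K) (\<sigma> / s)"
  have t: "1 < t" and "t ^ Suc K = \<sigma> / s"
    using \<sigma> \<open>0 < s\<close> by (simp_all add: t_def del: power_Suc)
  then have "t ^ K \<le> \<sigma> / s"
    by (metis power_increasing[of K "Suc K" t] le_SucI order_refl less_imp_le)
  then have tK: "t ^ K * s \<le> \<sigma>" using \<open>0 < s\<close> by (simp add: le_divide_eq)
  obtain C where C: "0 < C" "\<And>k. v k \<le> C * t ^ nat \<bar>k\<bar>"
    using subexponential[OF t] by blast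
  \<comment> \<open>The relative gap: Bernoulli's inequality
    \<open>1 + m d \<le> (1 + d) ^ m\<close> pays for the number of points, since
    \<open>2 m K + 1 \<le> (2 K / d + 1) (1 + m d)\<close>. This dictates \<open>B\<close>.\<close>
  define d where "d = \<rho> / \<sigma> - 1"
  have d: "0 < d" and \<rho>: "\<rho> = (1 + d) * \<sigma>" using \<sigma> \<open>0 < s\<close> by (simp_all add: d_def)
  define B where "B = C * (2 * real K / d + 1)"
  have "wbound v (B * \<rho> ^ m) (coef (p ^ m))" for m
    unfolding wbound_def
  proof safe
    fix F :: "int set" assume F: "finite F"
    define N where "N = m * K"
    define I where "I = {- int N..int N}"
    have out: "coef (p ^ m) k = 0" if "k \<notin> I" for k
      by (rule coef_power_support[where K = K, OF supp])
        (use that in \<open>auto simp: I_def N_def[symmetric] simp del: of_nat_mult\<close>)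
    have "(\<Sum>k\<in>F. cmod (coef (p ^ m) k) * v k) = (\<Sum>k\<in>F \<inter> I. cmod (coef (p ^ m) k) * v k)"
      using F out by (intro sum.mono_neutral_right) auto
    also have "\<dots> \<le> (\<Sum>k\<in>I. cmod (coef (p ^ m) k) * v k)"
      by (intro sum_mono2) (auto simp: nonneg I_def)
    also have "\<dots> \<le> (\<Sum>k\<in>I. s ^ m * (C * t ^ N))"
    proof (intro sum_mono mult_mono)
      fix k assume k: "k \<in> I"
      show "cmod (coef (p ^ m) k) \<le> s ^ m" by (rule l2bound_pointwise[OF l2])
      have "nat \<bar>k\<bar> \<le> N" using k by (auto simp: I_def)
      then have "t ^ nat \<bar>k\<bar> \<le> t ^ N" using t by (intro power_increasing) auto
      then show "v k \<le> C * t ^ N"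
        using C by (meson mult_left_mono less_imp_le order_trans)
    qed (use \<open>0 < s\<close> nonneg in auto)
    also have "\<dots> = (2 * real m * real K + 1) * C * (t ^ K * s) ^ m"
      by (simp add: I_def N_def power_mult_distrib power_mult mult.commute[of m] algebra_simps nat_add_distrib)
    also have "\<dots> \<le> (2 * real m * real K + 1) * C * \<sigma> ^ m"
      using tK \<open>0 < s\<close> C t by (intro mult_left_mono power_mono) auto
    also have "\<dots> \<le> B * (1 + real m * d) * \<sigma> ^ m"
    proof (rule mult_right_mono)
      have "2 * real m * real K + 1 \<le> (2 * real K / d + 1) * (1 + real m * d)"
        using d by (simp add: field_simps)
      then show "(2 * real m * real K + 1) * C \<le> B * (1 + real m * d)"
        using C mult_right_mono[of "2 * real m * real K + 1" "(2 * real K / d + 1) * (1 + real m * d)" C]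
        by (simp add: B_def mult_ac)
    qed (use \<sigma> \<open>0 < s\<close> in simp)
    also have "\<dots> \<le> B * (1 + d) ^ m * \<sigma> ^ m"
      using d C \<sigma> \<open>0 < s\<close> Bernoulli_inequality[of d m]
      by (intro mult_right_mono mult_left_mono) (auto simp: B_def)
    also have "\<dots> = B * \<rho> ^ m" by (simp add: \<rho> power_mult_distrib)
    finally show "(\<Sum>k\<in>F. cmod (coef (p ^ m) k) * v k) \<le> B * \<rho> ^ m" .
  qed
  moreover have "0 \<le> B" using C d by (simp add: B_def)
  ultimately show ?thesis by (intro that)
qed

text \<open>Cut \<open>b\<close> into a finitely supported \<open>p\<close> and a remainder
  \<open>q\<close> of weighted norm at most \<open>\<epsilon>\<close>. The \<open>ell2\<close> bound
  passes from \<open>b\<close> to \<open>p\<close> with a small loss, finite support makes it a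
  weighted bound, and commutativity allows \<open>q\<close> to be put back.\<close>

lemma wbound_power_of_contraction:
  assumes b: "\<And>C x. l2bound C x \<Longrightarrow> l2bound (r * C) (conv (coef b) x)"
    and bv: "wbound v B (coef b)" and r: "0 \<le> r" "r < \<rho>"
  obtains C where "0 \<le> C" "\<And>n. wbound v (C * \<rho> ^ n) (coef (b ^ n))"
proof -
  \<comment> \<open>Each third of the gap is spent once: on the \<open>ell2\<close> loss from
    \<open>b\<close> to \<open>p\<close>, on the strict inequality required in the finitely
    supported case, and on restoring \<open>q\<close>.\<close>
  define \<epsilon> where "\<epsilon> = (\<rho> - r) / 3"
  have \<epsilon>: "0 < \<epsilon>" using r by (simp add: \<epsilon>_def)
  obtain K where K: "wbound v \<epsilon> (\<lambda>k. if \<bar>k\<bar> \<le> int K then 0 else coef b k)"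
    using wbound_tail[OF bv nonneg \<epsilon>] .
  define q where "q = Abs_l1 (\<lambda>k. if \<bar>k\<bar> \<le> int K then 0 else coef b k)"
  have "wbound (\<lambda>_. 1) \<epsilon> (\<lambda>k. if \<bar>k\<bar> \<le> int K then 0 else coef b k)"
    by (rule wbound_weight_mono[OF K ge1])
  from wbound_summable[OF this]
  have cq: "coef q = (\<lambda>k. if \<bar>k\<bar> \<le> int K then 0 else coef b k)"
    by (simp add: q_def coef_Abs)
  have q: "wbound v \<epsilon> (coef q)" using K by (simp add: cq)
  define p where "p = b - q"
  have supp: "coef p k = 0" if "int K < \<bar>k\<bar>" for k
    using that by (simp add: p_def coef_diff cq)
  obtain C where C: "0 \<le> C" "\<And>m. wbound v (C * (r + 2 * \<epsilon>) ^ m) (coef (p ^ m))"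
  proof (rule wbound_power_finite_support[where s = "r + \<epsilon>" and \<rho> = "r + 2 * \<epsilon>", OF supp])
    show "l2bound ((r + \<epsilon>) ^ m) (coef (p ^ m))" for m
      by (rule l2bound_power_perturb[OF b wbound_weight_mono[OF q ge1] p_def])
  qed (use \<epsilon> r in auto)
  \<comment> \<open>The free exponent \<open>m\<close> lets the induction replace one
    \<open>b\<close> by \<open>p + q\<close>; the two terms contribute the rates
    \<open>r + 2 * \<epsilon>\<close> and \<open>\<epsilon>\<close>, which add up to
    \<open>\<rho>\<close>.\<close>
  have "wbound v (C * (\<rho> ^ n * (r + 2 * \<epsilon>) ^ m)) (coef (b ^ n * p ^ m))" for n m
  proof (induction n arbitrary: m)
    case 0
    then show ?case using C by simp
  next
    case (Suc n)
    have "b ^ Suc n * p ^ m = b ^ n * p ^ Suc m + q * (b ^ n * p ^ m)"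
      by (simp add: p_def algebra_simps)
    then have "coef (b ^ Suc n * p ^ m)
        = (\<lambda>k. coef (b ^ n * p ^ Suc m) k + conv (coef q) (coef (b ^ n * p ^ m)) k)"
      by (simp only: coef_add coef_mult[of q])
    moreover have "C * (\<rho> ^ Suc n * (r + 2 * \<epsilon>) ^ m)
        = C * (\<rho> ^ n * (r + 2 * \<epsilon>) ^ Suc m) + \<epsilon> * (C * (\<rho> ^ n * (r + 2 * \<epsilon>) ^ m))"
    proof -
      have "\<rho> = r + 2 * \<epsilon> + \<epsilon>" by (simp add: \<epsilon>_def field_simps)
      then have "\<rho> ^ Suc n = \<rho> ^ n * (r + 2 * \<epsilon> + \<epsilon>)" by simp
      then show ?thesis by (simp add: algebra_simps)
    qed
    ultimately show ?case
      using wbound_add[OF Suc[of "Suc m"] wbound_conv[OF q Suc[of m] ge1 submult] nonneg]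
      by (simp only:)
  qed
  from this[of _ 0] show ?thesis using C(1) by (intro that[of C]) auto
qed

end

subsection \<open>Summability of the inverse\<close>

text \<open>Surjectivity of the operator on \<open>ell2\<close> makes \<open>inv_into\<close> return
  an actual preimage of the unit vector, and \<open>\<alpha>\<close> is column 0 of the
  inverse.\<close>

lemma inverse_matrix_toeplitz_column:
  assumes "hermitian_positive_definite (toeplitz a)"
    and "inverse_matrix (toeplitz a) = toeplitz \<alpha>"
  shows "\<alpha> \<in> ell2" "conv a \<alpha> = indicator {0}"
proof -
  let ?e = "indicator {0} :: int \<Rightarrow> complex"
  have e: "?e \<in> ell2"
    using wbound_imp_l2bound[OF wbound_one[of "\<lambda>_. 1"]] l2bound_iff_ell2[of 1] by (simp add: coef_1)
  obtain S where S: "ell2_bounded_operator S" "\<forall>x\<in>ell2. conv a (S x) = x"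
    using assms(1) unfolding hermitian_positive_definite_def ell2_boundedly_invertible_def
      matrix_operator_toeplitz by blast
  have "?e \<in> conv a ` ell2"
    using S e unfolding ell2_bounded_operator_def by (metis image_eqI)
  moreover have "\<alpha> = inv_into ell2 (conv a) ?e"
    using fun_cong[OF fun_cong[OF assms(2)], of _ 0]
    by (simp add: inverse_matrix_def toeplitz_def matrix_operator_toeplitz[unfolded toeplitz_def] fun_eq_iff)
  ultimately show "\<alpha> \<in> ell2" "conv a \<alpha> = ?e"
    by (simp_all add: inv_into_into f_inv_into_f)
qed

lemma conv_scale: "conv x (\<lambda>k. c * z k) = (\<lambda>k. c * conv x z k)"
  by (rule ext) (simp add: conv_def mult.left_commute[of _ c] infsum_cmult_right')

lemma ell2_bounded:
  assumes "x \<in> ell2"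
  obtains Z where "\<And>k. cmod (x k) \<le> Z"
  using l2bound_iff_ell2[of "sqrt (rinner x x)" x] assms l2bound_pointwise
  by (metis order_refl real_sqrt_ge_zero real_sqrt_pow2 rinner_self_nonneg)

context grs_weight
begin

lemma wbound_abs_summable: "wbound v C x \<Longrightarrow> x abs_summable_on UNIV"
  using wbound_summable[OF wbound_weight_mono[of v C x "\<lambda>_. 1"]] ge1 by simp

lemma wbound_pointwise:
  assumes "wbound v C x"
  shows "cmod (x k) \<le> C"
  using wboundD[OF wbound_weight_mono[OF assms ge1], of "{k}"] by simp

text \<open>The partial sums of the Neumann series have weighted norms bounded by one geometric
  series and converge pointwise to \<open>\<alpha>\<close>; the bound on finite sums passes to the
  limit.\<close>

theorem inverse_wbound:
  assumes hpd: "hermitian_positive_definite (toeplitz a)" and a: "wbound v B a"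
    and \<alpha>: "\<alpha> \<in> ell2" "conv a \<alpha> = indicator {0}"
  obtains C where "wbound v C \<alpha>"
proof -
  obtain M r :: real where r: "0 \<le> r" "r < 1"
    and R: "\<forall>x\<in>ell2. damped (toeplitz a) M x \<in> ell2
      \<and> rinner (damped (toeplitz a) M x) (damped (toeplitz a) M x) \<le> r\<^sup>2 * rinner x x"
    using hermitian_positive_definite_contraction[OF hpd] .
  define c where "c = complex_of_real (1 / M)"
  define A where "A = Abs_l1 (\<lambda>k. c * a k)"
  have cA: "coef A = (\<lambda>k. c * a k)"
    unfolding A_def by (rule coef_Abs, rule wbound_abs_summable, rule wbound_cmult[OF a])
  have Ax: "conv (coef A) x = (\<lambda>k. c * conv a x k)" for x
    using conv_scale[of x c a] by (simp add: cA conv_commute[of _ x])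
  define b where "b = 1 - A"
  have bx: "conv (coef b) x = (\<lambda>k. x k - c * conv a x k)" if "\<And>k. cmod (x k) \<le> Z" for x Z
    using conv_l1_diff[OF that, of 1 A] by (simp add: b_def Ax coef_1 conv_unit)
  have b_contr: "l2bound (r * C) (conv (coef b) x)" if x: "l2bound C x" for C x
  proof -
    have C: "0 \<le> C" using l2bound_pointwise[OF x, of 0] norm_ge_zero order_trans by blast
    have x': "x \<in> ell2" "rinner x x \<le> C\<^sup>2" using x l2bound_iff_ell2[OF C] by auto
    have "r\<^sup>2 * rinner x x \<le> (r * C)\<^sup>2"
      using x'(2) by (simp add: power_mult_distrib mult_left_mono)
    then show ?thesis
      using bspec[OF R x'(1)] l2bound_iff_ell2[of "r * C"] r(1) C
      by (simp add: bx[OF l2bound_pointwise[OF x]] c_def damped_def matrix_operator_toeplitz)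
  qed
  have bv: "wbound v (v 0 + cmod c * B) (coef b)"
    using wbound_add[OF wbound_one[OF nonneg] wbound_minus[THEN iffD2, OF wbound_cmult[OF a, of c]] nonneg]
    by (simp add: b_def coef_diff cA)
  define \<rho> where "\<rho> = (1 + r) / 2"
  have \<rho>: "r < \<rho>" "0 \<le> \<rho>" "\<rho> < 1" using r by (simp_all add: \<rho>_def)
  obtain C where C: "0 \<le> C" "\<And>n. wbound v (C * \<rho> ^ n) (coef (b ^ n))"
    using wbound_power_of_contraction[OF b_contr bv r(1) \<rho>(1)] by blast
  obtain Z where Z: "\<And>k. cmod (\<alpha> k) \<le> Z" using ell2_bounded[OF \<alpha>(1)] by blast
  define X where "X n = (\<Sum>i<n. b ^ i)" for n
  have "wbound v (cmod c * (C / (1 - \<rho>))) \<alpha>"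
  proof (rule wbound_limit[where f = "\<lambda>n k. c * coef (X n) k"])
    fix n
    have "coef (X n) = (\<lambda>k. \<Sum>i<n. coef (b ^ i) k)"
      by (simp add: X_def coef_sum fun_eq_iff)
    then have "wbound v (\<Sum>i<n. C * \<rho> ^ i) (coef (X n))"
      using wbound_sum[of "{..<n}" v "\<lambda>i. C * \<rho> ^ i"] C(2) nonneg by simp
    moreover have "(\<Sum>i<n. C * \<rho> ^ i) \<le> C / (1 - \<rho>)"
    proof -
      have "(\<Sum>i<n. C * \<rho> ^ i) = C * ((1 - \<rho> ^ n) / (1 - \<rho>))"
        using \<rho> by (simp add: sum_distrib_left[symmetric] sum_gp_strict)
      also have "\<dots> \<le> C * (1 / (1 - \<rho>))"
        using \<rho> C(1) by (intro mult_left_mono divide_right_mono) auto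
      finally show ?thesis by simp
    qed
    ultimately show "wbound v (cmod c * (C / (1 - \<rho>))) (\<lambda>k. c * coef (X n) k)"
      by (intro wbound_cmult) (rule wbound_mono)
  next
    fix k
    \<comment> \<open>Telescoping gives \<open>1 - b ^ n = X n * A\<close>, and \<open>A\<close>
      maps \<open>\<alpha>\<close> to \<open>c\<close> times the unit. The remainder tends to 0
      because \<open>\<alpha>\<close> is bounded.\<close>
    have rest: "\<alpha> k - c * coef (X n) k = conv (coef (b ^ n)) \<alpha> k" for n
    proof -
      have "1 - b ^ n = X n * A"
        by (simp add: X_def one_diff_power_eq b_def mult.commute)
      then have "(\<lambda>k. \<alpha> k - conv (coef (b ^ n)) \<alpha> k) = conv (coef (X n)) (conv (coef A) \<alpha>)"
        using conv_l1_diff[OF Z, of 1 "b ^ n"] conv_l1_mult[OF Z, of "X n" A]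
        by (simp add: coef_1 conv_unit)
      also have "\<dots> = (\<lambda>k. c * coef (X n) k)"
        by (simp add: Ax \<alpha>(2) conv_scale conv_commute[of _ "indicator {0}"] conv_unit)
      finally show ?thesis by (simp add: fun_eq_iff algebra_simps)
    qed
    have small: "cmod (conv (coef (b ^ n)) \<alpha> k) \<le> C * Z * \<rho> ^ n" for n
    proof -
      have "(\<Sum>\<^sub>\<infinity>k. cmod (coef (b ^ n) k)) \<le> C * \<rho> ^ n"
        using wbound_infsum[OF wbound_weight_mono[OF C(2) ge1]] by simp
      moreover have "0 \<le> Z" using Z[of 0] norm_ge_zero order_trans by blast
      ultimately have "(\<Sum>\<^sub>\<infinity>k. cmod (coef (b ^ n) k)) * Z \<le> C * \<rho> ^ n * Z"
        by (rule mult_right_mono)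
      then show ?thesis
        using norm_conv_le[where z = \<alpha> and k = k, OF coef_summable[of "b ^ n"] Z] by (simp add: mult_ac)
    qed
    have "(\<lambda>n. \<alpha> k - c * coef (X n) k) \<longlonglongrightarrow> 0"
    proof (rule Lim_null_comparison)
      show "\<forall>\<^sub>F n in sequentially. norm (\<alpha> k - c * coef (X n) k) \<le> C * Z * \<rho> ^ n"
        by (simp add: rest small)
      show "(\<lambda>n. C * Z * \<rho> ^ n) \<longlonglongrightarrow> 0"
        by (intro tendsto_mult_right_zero LIMSEQ_power_zero) (use \<rho> in simp)
    qed
    from tendsto_diff[OF tendsto_const[of "\<alpha> k"] this]
    show "(\<lambda>n. c * coef (X n) k) \<longlonglongrightarrow> \<alpha> k" by simp
  qed
  then show ?thesis by (rule that)
qed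

end

subsection \<open>Pointwise decay of the inverse\<close>

locale grs_decay = grs_weight +
  fixes u :: "int \<Rightarrow> real"
  assumes decay_pos: "0 < u k"
    and dominated: "\<bar>j\<bar> \<le> \<bar>i\<bar> \<Longrightarrow> u i \<le> v j * u (i + j)"
begin

text \<open>In each product \<open>x (k - l) * y l\<close> the factor whose index has the larger
  modulus supplies the decay \<open>u k\<close>, and the other one pays with the weight
  \<open>v\<close> at its own index.\<close>

lemma conv_decay:
  assumes "\<And>k. cmod (x k) \<le> X * u k" "\<And>k. cmod (y k) \<le> Y * u k"
    and x: "wbound v X' x" and y: "wbound v Y' y"
  shows "cmod (conv x y k) \<le> (X * Y' + Y * X') * u k"
proof -
  have nn: "0 \<le> X" "0 \<le> Y"
    using order_trans[OF norm_ge_zero assms(1), of 0] order_trans[OF norm_ge_zero assms(2), of 0]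
      decay_pos[of 0] by (simp_all add: zero_le_mult_iff)
  have half: "cmod (z i * w j) \<le> W * u (i + j) * (cmod (w j) * v j)"
    if "\<And>k. cmod (z k) \<le> W * u k" "\<bar>j\<bar> \<le> \<bar>i\<bar>" "0 \<le> W" for z w W i j
  proof -
    have "cmod (z i) \<le> W * (v j * u (i + j))"
      using that(1)[of i] mult_left_mono[OF dominated[OF that(2)] that(3)] by linarith
    from mult_right_mono[OF this norm_ge_zero[of "w j"]] show ?thesis
      by (simp add: norm_mult mult_ac)
  qed
  have s1: "(\<lambda>l. cmod (y l) * v l) summable_on UNIV"
    by (rule wbound_summable[OF y nonneg])
  have s2: "(\<lambda>l. cmod (x (k - l)) * v (k - l)) summable_on UNIV"
    using wbound_summable[OF x nonneg]
      summable_on_reindex_bij_betw[OF bij_int_reflect[of k], of "\<lambda>l. cmod (x l) * v l"] by simp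
  have i2: "(\<Sum>\<^sub>\<infinity>l. cmod (x (k - l)) * v (k - l)) \<le> X'"
    using wbound_infsum[OF x nonneg]
      infsum_reindex_bij_betw[OF bij_int_reflect[of k], of "\<lambda>l. cmod (x l) * v l"] by simp
  have le: "cmod (x (k - l) * y l)
      \<le> X * u k * (cmod (y l) * v l) + Y * u k * (cmod (x (k - l)) * v (k - l))" for l
  proof (cases "\<bar>l\<bar> \<le> \<bar>k - l\<bar>")
    case True
    have "0 \<le> Y * u k * (cmod (x (k - l)) * v (k - l))"
      using nn decay_pos[of k] nonneg by simp
    with half[OF assms(1) True nn(1), of y] show ?thesis by simp
  next
    case False
    have "0 \<le> X * u k * (cmod (y l) * v l)"
      using nn decay_pos[of k] nonneg by simp
    with half[OF assms(2) _ nn(2), of "k - l" l x] False show ?thesis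
      by (simp add: mult.commute[of "x (k - l)"])
  qed
  have "cmod (conv x y k) \<le> (\<Sum>\<^sub>\<infinity>l. cmod (x (k - l) * y l))"
    unfolding conv_def
    by (rule norm_infsum_bound[OF abs_summable_conv_kernel[OF wbound_abs_summable[OF x] wbound_pointwise[OF y]]])
  also have "\<dots> \<le> (\<Sum>\<^sub>\<infinity>l. X * u k * (cmod (y l) * v l)
      + Y * u k * (cmod (x (k - l)) * v (k - l)))"
    by (intro infsum_mono abs_summable_conv_kernel[OF wbound_abs_summable[OF x] wbound_pointwise[OF y]]
        summable_on_add summable_on_cmult_right s1 s2 le)
  also have "\<dots> = X * u k * (\<Sum>\<^sub>\<infinity>l. cmod (y l) * v l)
      + Y * u k * (\<Sum>\<^sub>\<infinity>l. cmod (x (k - l)) * v (k - l))"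
    by (subst infsum_add) (simp_all add: s1 s2 summable_on_cmult_right infsum_cmult_right')
  also have "\<dots> \<le> X * u k * Y' + Y * u k * X'"
    using wbound_infsum[OF y nonneg] i2 nn decay_pos[of k] by (intro add_mono mult_left_mono) auto
  finally show ?thesis by (simp add: algebra_simps)
qed

text \<open>The iteration contracts in the weighted norm. Since \<open>e\<close> has weighted norm
  at most 1/2, the bound relative to \<open>u\<close> obeys an affine recursion of slope 1/2 and so
  does not grow.\<close>

lemma inverse_decay:
  assumes inv: "x * y = 1" and xv: "wbound v A (coef x)" and yv: "wbound v B (coef y)"
    and xu: "\<And>k. cmod (coef x k) \<le> c * u k"
  obtains C where "\<And>k. cmod (coef y k) \<le> C * u k"
proof -
  have A0: "0 \<le> A" and B0: "0 \<le> B" using wbound_nonneg xv yv by auto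
  \<comment> \<open>Small enough that \<open>q * x\<close>, and with it \<open>e\<close>, has
    weighted norm at most 1/2.\<close>
  define \<epsilon> where "\<epsilon> = 1 / (2 * A + 2)"
  have \<epsilon>: "0 < \<epsilon>" "\<epsilon> * A \<le> 1 / 2" using A0 by (simp_all add: \<epsilon>_def field_simps)
  obtain K where K: "wbound v \<epsilon> (\<lambda>k. if \<bar>k\<bar> \<le> int K then 0 else coef y k)"
    using wbound_tail[OF yv nonneg \<epsilon>(1)] .
  define q where "q = Abs_l1 (\<lambda>k. if \<bar>k\<bar> \<le> int K then 0 else coef y k)"
  have cq: "coef q = (\<lambda>k. if \<bar>k\<bar> \<le> int K then 0 else coef y k)"
    unfolding q_def by (rule coef_Abs[OF wbound_abs_summable[OF K]])
  have qv: "wbound v \<epsilon> (coef q)" using K by (simp add: cq)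
  define p where "p = y - q"
  define e where "e = p * x - 1"
  have "e = - (q * x)" using inv by (simp add: e_def p_def algebra_simps)
  then have ev: "wbound v (1 / 2) (coef e)"
    using wbound_mono[OF wbound_conv[OF qv xv ge1 submult] \<epsilon>(2)]
    by (simp add: coef_minus coef_mult wbound_minus)
  have pv: "wbound v (B + \<epsilon>) (coef p)"
    using wbound_add[OF yv wbound_minus[THEN iffD2, OF qv] nonneg] by (simp add: p_def coef_diff)
  \<comment> \<open>As \<open>p\<close> has finite support, the sum of the ratios is a constant
    dominating each of them.\<close>
  define P where "P = (\<Sum>k\<in>{- int K..int K}. cmod (coef y k) / u k)"
  have P0: "0 \<le> P" unfolding P_def using decay_pos by (intro sum_nonneg) (simp add: less_imp_le)
  have pu: "cmod (coef p k) \<le> P * u k" for k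
  proof (cases "\<bar>k\<bar> \<le> int K")
    case True
    then have "cmod (coef y k) / u k \<le> P"
      unfolding P_def using decay_pos by (intro member_le_sum) (auto simp: less_imp_le)
    then show ?thesis using True decay_pos[of k] by (simp add: p_def coef_diff cq divide_le_eq)
  next
    case False
    then show ?thesis using P0 decay_pos[of k] by (simp add: p_def coef_diff cq)
  qed
  define E where "E = P * A + c * (B + \<epsilon>) + 1 / u 0"
  have eu: "cmod (coef e k) \<le> E * u k" for k
  proof -
    have "cmod (coef e k) \<le> cmod (conv (coef p) (coef x) k) + cmod (coef 1 k)"
      by (simp add: e_def coef_diff coef_mult norm_triangle_ineq4)
    moreover have "cmod (coef 1 k) \<le> 1 / u 0 * u k"
      using decay_pos[of k] decay_pos[of 0] by (simp add: coef_1 indicator_def)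
    moreover have "cmod (conv (coef p) (coef x) k) \<le> (P * A + c * (B + \<epsilon>)) * u k"
      by (rule conv_decay[OF pu xu pv xv])
    ultimately show ?thesis by (simp add: E_def algebra_simps)
  qed
  have fix_y: "y = p - e * y"
    using inv by (simp add: e_def algebra_simps)
  define f where "f z = p - e * z" for z
  define X where "X n = (f ^^ n) 0" for n
  \<comment> \<open>\<open>D\<close> and \<open>L\<close> are the fixed points of the recursions for
    the two bounds: \<open>D = B + \<epsilon> + D / 2\<close> and
    \<open>L = P + E * D + L / 2\<close>.\<close>
  define D where "D = 2 * (B + \<epsilon>)"
  define L where "L = 2 * (P + E * D)"
  have bounds: "wbound v D (coef (X n)) \<and> (\<forall>k. cmod (coef (X n) k) \<le> L * u k)
      \<and> wbound v (B * (1 / 2) ^ n) (coef (X n - y))" for n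
  proof (induction n)
    case 0
    have "0 \<le> E * u 0" using order_trans[OF norm_ge_zero eu[of 0]] .
    then have "0 \<le> E" using decay_pos[of 0] by (simp add: zero_le_mult_iff)
    then have "0 \<le> D" "0 \<le> L" using P0 B0 \<epsilon> by (simp_all add: D_def L_def)
    then show ?case
      using yv decay_pos by (simp add: X_def coef_0 coef_minus wbound_minus less_imp_le)
        (simp add: wbound_def)
  next
    case (Suc n)
    have Xn: "wbound v D (coef (X n))" "\<And>k. cmod (coef (X n) k) \<le> L * u k"
      and d: "wbound v (B * (1 / 2) ^ n) (coef (X n - y))" using Suc by auto
    have X: "X (Suc n) = p - e * X n" by (simp add: X_def f_def)
    have "wbound v (B + \<epsilon> + 1 / 2 * D) (coef (X (Suc n)))"
      using wbound_add[OF pv wbound_minus[THEN iffD2, OF wbound_conv[OF ev Xn(1) ge1 submult]] nonneg]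
      by (simp add: X coef_diff coef_mult)
    moreover have "B + \<epsilon> + 1 / 2 * D = D" by (simp add: D_def)
    moreover have "cmod (coef (X (Suc n)) k) \<le> L * u k" for k
    proof -
      have "cmod (coef (X (Suc n)) k) \<le> cmod (coef p k) + cmod (conv (coef e) (coef (X n)) k)"
        by (simp add: X coef_diff coef_mult norm_triangle_ineq4)
      also have "\<dots> \<le> P * u k + (E * D + L * (1 / 2)) * u k"
        by (intro add_mono pu conv_decay[OF eu Xn(2) ev Xn(1)])
      also have "\<dots> = L * u k" by (simp add: L_def algebra_simps)
      finally show ?thesis .
    qed
    \<comment> \<open>Subtracting the fixed-point equation for \<open>y\<close> halves the error
      bound at each step; it starts at \<open>B\<close> because
      \<open>X 0 - y = - y\<close>.\<close>
    moreover have "X (Suc n) - y = - (e * (X n - y))"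
      using fix_y by (simp add: X algebra_simps)
    then have "wbound v (B * (1 / 2) ^ Suc n) (coef (X (Suc n) - y))"
      using wbound_conv[OF ev d ge1 submult]
      by (simp add: coef_minus coef_mult wbound_minus mult_ac)
    ultimately show ?case by simp
  qed
  have "cmod (coef y k) \<le> L * u k" for k
  proof (rule LIMSEQ_le_const2)
    have "(\<lambda>n. B * (1 / 2) ^ n) \<longlonglongrightarrow> 0"
      by (intro tendsto_mult_right_zero LIMSEQ_power_zero) simp
    then have "(\<lambda>n. coef (X n - y) k) \<longlonglongrightarrow> 0"
      by (rule Lim_null_comparison[rotated]) (use bounds wbound_pointwise in auto)
    then have "(\<lambda>n. coef (X n) k) \<longlonglongrightarrow> coef y k"
      by (simp add: coef_diff LIM_zero_iff)
    then show "(\<lambda>n. cmod (coef (X n) k)) \<longlonglongrightarrow> cmod (coef y k)"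
      by (rule tendsto_norm)
    show "\<exists>N. \<forall>n\<ge>N. cmod (coef (X n) k) \<le> L * u k" using bounds by blast
  qed
  then show ?thesis by (rule that)
qed

text \<open>Summability of \<open>u * v\<close> places \<open>a\<close> in the weighted algebra,
  hence also \<open>\<alpha>\<close>; the decay is then transferred through the ring identity
  between them.\<close>

lemma toeplitz_inverse_decay:
  assumes hpd: "hermitian_positive_definite (toeplitz a)"
    and \<alpha>: "inverse_matrix (toeplitz a) = toeplitz \<alpha>"
    and au: "\<And>k. cmod (a k) \<le> c * u k" and summable: "(\<lambda>k. u k * v k) summable_on UNIV"
  obtains C where "0 < C" "\<And>k. cmod (\<alpha> k) < C * u k"
proof -
  note col = inverse_matrix_toeplitz_column[OF hpd \<alpha>]
  have "(\<lambda>k. norm (cmod (a k) * v k)) summable_on UNIV"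
    by (rule Infinite_Sum.abs_summable_on_comparison_test'[OF summable_on_cmult_right[OF summable, of c]])
      (use mult_right_mono[OF au nonneg] nonneg in \<open>auto simp: abs_mult mult.assoc\<close>)
  then have "(\<lambda>k. cmod (a k) * v k) summable_on UNIV" by (simp add: abs_mult nonneg)
  from summable_imp_wbound[OF this nonneg]
  obtain A where A: "wbound v A a" by blast
  obtain B where B: "wbound v B \<alpha>"
    using inverse_wbound[OF hpd A col] .
  have ca: "coef (Abs_l1 a) = a" and c\<alpha>: "coef (Abs_l1 \<alpha>) = \<alpha>"
    by (rule coef_Abs[OF wbound_abs_summable[OF A]], rule coef_Abs[OF wbound_abs_summable[OF B]])
  have inv: "Abs_l1 a * Abs_l1 \<alpha> = 1"
    by (rule coef_inject[THEN iffD1]) (simp add: coef_mult ca c\<alpha> col coef_1)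
  obtain C where C: "\<And>k. cmod (\<alpha> k) \<le> C * u k"
    using inverse_decay[OF inv, unfolded ca c\<alpha>, OF A B au] by blast
  have "0 \<le> C"
    using order_trans[OF norm_ge_zero C, of 0] decay_pos[of 0] by (simp add: zero_le_mult_iff)
  \<comment> \<open>Raising the constant by 1 makes the inequality strict and the constant
    positive.\<close>
  moreover have "cmod (\<alpha> k) < (C + 1) * u k" for k
    using C[of k] decay_pos[of k] by (simp add: distrib_right)
  ultimately show ?thesis by (intro that[of "C + 1"]) auto
qed

end

subsection \<open>Polynomial and subexponential decay\<close>

lemma summable_on_int_abs:
  fixes f :: "nat \<Rightarrow> real"
  assumes "summable f" "\<And>n. 0 \<le> f n"
  shows "(\<lambda>k::int. f (nat \<bar>k\<bar>)) summable_on UNIV"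
proof -
  have f: "f summable_on UNIV"
    using assms by (simp add: summable_on_UNIV_nonneg_real_iff)
  have "(\<lambda>k::int. f (nat \<bar>k\<bar>)) summable_on range int"
    using f by (subst summable_on_reindex) (auto simp: o_def inj_on_def)
  moreover have "(\<lambda>k::int. f (nat \<bar>k\<bar>)) summable_on range (\<lambda>n. - int n)"
    using f by (subst summable_on_reindex) (auto simp: o_def inj_on_def)
  ultimately have "(\<lambda>k::int. f (nat \<bar>k\<bar>)) summable_on (range int \<union> range (\<lambda>n. - int n))"
    by (rule summable_on_union)
  also have "range int \<union> range (\<lambda>n. - int n) = UNIV"
    by (auto simp: image_iff) (metis int_cases)
  finally show ?thesis .
qed

text \<open>For \<open>\<bar>j\<bar> \<le> \<bar>i\<bar>\<close> one has
  \<open>1 + \<bar>i + j\<bar> \<le> 2 * (1 + \<bar>i\<bar>)\<close>, so a polynomial rate changes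
  by at most the constant \<open>2 powr s\<close>, and a constant weight of at least 1 is
  submultiplicative.\<close>

lemma grs_decay_poly:
  assumes "1 < s"
  shows "grs_decay (\<lambda>_. 2 powr s) (\<lambda>k. (1 + real_of_int \<bar>k\<bar>) powr (- s))"
proof unfold_locales
  fix i j k l :: int
  have "1 \<le> (2::real) powr s" using assms by (simp add: ge_one_powr_ge_zero)
  then show "(2::real) powr s \<le> 2 powr s * 2 powr s" by simp
  show "(\<lambda>n. root n ((2::real) powr s)) \<longlonglongrightarrow> 1"
    by (rule LIMSEQ_root_const) simp
  show "0 < (1 + real_of_int \<bar>k\<bar>) powr (- s)"
    by (simp add: add_pos_nonneg)
  assume ij: "\<bar>j\<bar> \<le> \<bar>i\<bar>"
  have "\<bar>i + j\<bar> \<le> 2 * \<bar>i\<bar>" using ij by linarith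
  then have "real_of_int \<bar>i + j\<bar> \<le> real_of_int (2 * \<bar>i\<bar>)"
    by (simp only: of_int_le_iff)
  then have "1 + real_of_int \<bar>i + j\<bar> \<le> 2 * (1 + real_of_int \<bar>i\<bar>)"
    by simp
  then have "(1 + real_of_int \<bar>i + j\<bar>) powr s \<le> (2 * (1 + real_of_int \<bar>i\<bar>)) powr s"
    using assms by (intro powr_mono2) auto
  also have "\<dots> = 2 powr s * (1 + real_of_int \<bar>i\<bar>) powr s"
    by (rule powr_mult)
  finally have "(1 + real_of_int \<bar>i + j\<bar>) powr s \<le> 2 powr s * (1 + real_of_int \<bar>i\<bar>) powr s" .
  moreover have "0 < (1 + real_of_int \<bar>i + j\<bar>) powr s" "0 < (1 + real_of_int \<bar>i\<bar>) powr s"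
    by (simp_all add: add_pos_nonneg)
  ultimately show "(1 + real_of_int \<bar>i\<bar>) powr (- s) \<le> 2 powr s * (1 + real_of_int \<bar>i + j\<bar>) powr (- s)"
    by (simp add: powr_minus field_simps)
qed simp

lemma summable_poly:
  assumes "1 < s"
  shows "(\<lambda>k::int. (1 + real_of_int \<bar>k\<bar>) powr (- s) * 2 powr s) summable_on UNIV"
proof -
  have "summable (\<lambda>n. real (Suc n) powr (- s))"
    using assms by (subst summable_Suc_iff) (simp add: summable_real_powr_iff)
  then have "(\<lambda>k::int. real (Suc (nat \<bar>k\<bar>)) powr (- s)) summable_on UNIV"
    by (rule summable_on_int_abs) simp
  then have "(\<lambda>k::int. (1 + real_of_int \<bar>k\<bar>) powr (- s)) summable_on UNIV"
    by (simp add: add.commute)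
  then show ?thesis by (rule summable_on_cmult_left)
qed

text \<open>Sharper than subadditivity: the smaller term carries the factor \<open>\<beta>\<close>.
  After factoring out \<open>x\<close>, the ratio \<open>t = y / x \<le> 1\<close> satisfies
  \<open>(1 + t) powr \<beta> \<le> 1 + \<beta> * t\<close> and
  \<open>t \<le> t powr \<beta>\<close>.\<close>

lemma powr_add_le:
  fixes x y :: real
  assumes "0 < \<beta>" "\<beta> < 1" "0 \<le> y" "y \<le> x"
  shows "(x + y) powr \<beta> \<le> x powr \<beta> + \<beta> * y powr \<beta>"
proof (cases "y = 0")
  case False
  then have x: "0 < x" and y: "0 < y" using assms by auto
  have "(x + y) powr \<beta> = (x * (1 + y / x)) powr \<beta>"
    using x by (simp add: distrib_left)
  also have "\<dots> = x powr \<beta> * (1 + y / x) powr \<beta>"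
    using x y by (simp add: powr_mult)
  also have "(1 + y / x) powr \<beta> \<le> 1 + \<beta> * (y / x)"
  proof -
    \<comment> \<open>Concavity of \<open>ln\<close> between 1 and \<open>1 + y / x\<close>, where
      \<open>ln 1 = 0\<close>.\<close>
    have "\<beta> * ln (1 + y / x) \<le> ln (1 + \<beta> * (y / x))"
      using concave_onD[OF ln_concave, of \<beta> 1 "1 + y / x"] assms x y add_pos_pos[of 1 "y / x"]
      by (simp add: algebra_simps)
    then have "exp (\<beta> * ln (1 + y / x)) \<le> exp (ln (1 + \<beta> * (y / x)))" by simp
    then show ?thesis using x y assms by (simp add: powr_def add_pos_nonneg)
  qed
  also have "y / x \<le> (y / x) powr \<beta>"
    using powr_mono'[of \<beta> 1 "y / x"] assms x y by simp
  also have "x powr \<beta> * (1 + \<beta> * (y / x) powr \<beta>) = x powr \<beta> + \<beta> * y powr \<beta>"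
    using x y by (simp add: powr_divide field_simps)
  finally show ?thesis using assms by (simp add: mult_left_mono)
qed (use assms in simp)

lemma powr_add_le_add:
  fixes x y :: real
  assumes "0 < \<beta>" "\<beta> < 1" "0 \<le> x" "0 \<le> y"
  shows "(x + y) powr \<beta> \<le> x powr \<beta> + y powr \<beta>"
proof -
  have *: "\<beta> * t powr \<beta> \<le> t powr \<beta>" for t :: real
    using assms(2) by (intro mult_left_le_one_le) (use assms in auto)
  show ?thesis
    using powr_add_le[OF assms(1,2), of y x] powr_add_le[OF assms(1,2), of x y] assms *[of x] *[of y]
    by (cases "y \<le> x") (auto simp: add.commute)
qed

text \<open>The factor \<open>\<beta>\<close> in the weight comes from the sharpened subadditivity.
  It leaves \<open>u * v\<close> with exponent
  \<open>- \<gamma> * (1 - \<beta>) * \<bar>k\<bar> powr \<beta>\<close>, which is summable; the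
  weight \<open>1 / u\<close> would give only the constant 1.\<close>

lemma grs_decay_exp:
  assumes "0 < \<gamma>" "0 < \<beta>" "\<beta> < 1"
  shows "grs_decay (\<lambda>k. exp (\<gamma> * \<beta> * real_of_int \<bar>k\<bar> powr \<beta>))
    (\<lambda>k. exp (- \<gamma> * real_of_int \<bar>k\<bar> powr \<beta>))"
proof unfold_locales
  fix i j k l :: int
  have "real_of_int \<bar>k + l\<bar> powr \<beta> \<le> (real_of_int \<bar>k\<bar> + real_of_int \<bar>l\<bar>) powr \<beta>"
    using assms by (intro powr_mono2) auto
  also have "\<dots> \<le> real_of_int \<bar>k\<bar> powr \<beta> + real_of_int \<bar>l\<bar> powr \<beta>"
    using assms by (intro powr_add_le_add) auto
  finally have "\<gamma> * \<beta> * real_of_int \<bar>k + l\<bar> powr \<beta>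
      \<le> \<gamma> * \<beta> * (real_of_int \<bar>k\<bar> powr \<beta> + real_of_int \<bar>l\<bar> powr \<beta>)"
    using assms by (intro mult_left_mono) auto
  then show "exp (\<gamma> * \<beta> * real_of_int \<bar>k + l\<bar> powr \<beta>)
      \<le> exp (\<gamma> * \<beta> * real_of_int \<bar>k\<bar> powr \<beta>) * exp (\<gamma> * \<beta> * real_of_int \<bar>l\<bar> powr \<beta>)"
    by (simp add: exp_add[symmetric] algebra_simps)
  \<comment> \<open>The exponent becomes \<open>\<gamma> * \<beta> * n powr (\<beta> - 1)\<close>,
    which tends to 0 because \<open>\<beta> < 1\<close>.\<close>
  have "(\<lambda>n. exp (\<gamma> * \<beta> * real n powr \<beta>) powr (1 / real n)) \<longlonglongrightarrow> 1"
    using assms by real_asymp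
  moreover have "\<forall>\<^sub>F n in sequentially.
      exp (\<gamma> * \<beta> * real n powr \<beta>) powr (1 / real n) = root n (exp (\<gamma> * \<beta> * real n powr \<beta>))"
    using eventually_gt_at_top[of 0] by eventually_elim (simp add: root_powr_inverse)
  ultimately have "(\<lambda>n. root n (exp (\<gamma> * \<beta> * real n powr \<beta>))) \<longlonglongrightarrow> 1"
    by (rule Lim_transform_eventually)
  then show "(\<lambda>n. root n (exp (\<gamma> * \<beta> * real_of_int \<bar>int n\<bar> powr \<beta>))) \<longlonglongrightarrow> 1"
    "(\<lambda>n. root n (exp (\<gamma> * \<beta> * real_of_int \<bar>- int n\<bar> powr \<beta>))) \<longlonglongrightarrow> 1"
    by simp_all
  assume ij: "\<bar>j\<bar> \<le> \<bar>i\<bar>"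
  have "real_of_int \<bar>i + j\<bar> powr \<beta> \<le> (real_of_int \<bar>i\<bar> + real_of_int \<bar>j\<bar>) powr \<beta>"
    using assms by (intro powr_mono2) auto
  also have "\<dots> \<le> real_of_int \<bar>i\<bar> powr \<beta> + \<beta> * real_of_int \<bar>j\<bar> powr \<beta>"
    using assms ij by (intro powr_add_le) auto
  finally have "\<gamma> * real_of_int \<bar>i + j\<bar> powr \<beta>
      \<le> \<gamma> * (real_of_int \<bar>i\<bar> powr \<beta> + \<beta> * real_of_int \<bar>j\<bar> powr \<beta>)"
    using assms by (intro mult_left_mono) auto
  then show "exp (- \<gamma> * real_of_int \<bar>i\<bar> powr \<beta>)
      \<le> exp (\<gamma> * \<beta> * real_of_int \<bar>j\<bar> powr \<beta>) * exp (- \<gamma> * real_of_int \<bar>i + j\<bar> powr \<beta>)"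
    by (simp add: exp_add[symmetric] algebra_simps)
qed simp_all

lemma summable_exp_powr:
  assumes "0 < \<gamma>" "0 < \<beta>" "\<beta> < 1"
  shows "(\<lambda>k::int. exp (- \<gamma> * real_of_int \<bar>k\<bar> powr \<beta>) * exp (\<gamma> * \<beta> * real_of_int \<bar>k\<bar> powr \<beta>))
    summable_on UNIV"
proof -
  define d where "d = \<gamma> * (1 - \<beta>)"
  have d: "0 < d" using assms by (simp add: d_def)
  have "summable (\<lambda>n. exp (- d * real n powr \<beta>))"
  proof (rule summable_comparison_test_bigo)
    show "summable (\<lambda>n. norm (real n powr (- 2)))" by (simp add: summable_real_powr_iff)
    show "(\<lambda>n. exp (- d * real n powr \<beta>)) \<in> O(\<lambda>n. real n powr (- 2))"
      using d assms by real_asymp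
  qed
  from summable_on_int_abs[OF this]
  have "(\<lambda>k::int. exp (- d * real_of_int \<bar>k\<bar> powr \<beta>)) summable_on UNIV" by simp
  then show ?thesis by (simp add: d_def exp_add[symmetric] algebra_simps)
qed

theorem theorem2p4:
  fixes a :: "int \<Rightarrow> complex"
  assumes "hermitian_positive_definite (toeplitz a)"
  shows "(\<forall>(\<alpha> :: int \<Rightarrow> complex) (v :: int \<Rightarrow> real).
            inverse_matrix (toeplitz a) = toeplitz \<alpha> \<longrightarrow>
            (\<forall>k. 0 < v k) \<longrightarrow>
            (\<forall>k l. v (k + l) \<le> v k * v l) \<longrightarrow>
            (\<lambda>k. cmod (a k) * v k) summable_on UNIV \<longrightarrow>
            (\<lambda>n. 1 / root n (v (- int n))) \<longlonglongrightarrow> 1 \<longrightarrow>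
            (\<lambda>n. root n (v (int n))) \<longlonglongrightarrow> 1 \<longrightarrow>
            (\<lambda>k. cmod (\<alpha> k) * v k) summable_on UNIV) \<and>
         (\<forall>s>1. toeplitz a \<in> poly_decay s \<longrightarrow>
            inverse_matrix (toeplitz a) \<in> poly_decay s) \<and>
         (\<forall>\<gamma> \<beta>. 0 < \<gamma> \<longrightarrow> 0 < \<beta> \<longrightarrow> \<beta> < 1 \<longrightarrow> toeplitz a \<in> exp_decay \<gamma> \<beta> \<longrightarrow>
            inverse_matrix (toeplitz a) \<in> exp_decay \<gamma> \<beta>)"
proof (intro conjI allI impI)
  fix \<alpha> :: "int \<Rightarrow> complex" and v :: "int \<Rightarrow> real"
  assume \<alpha>: "inverse_matrix (toeplitz a) = toeplitz \<alpha>"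
    and v: "\<forall>k. 0 < v k" "\<forall>k l. v (k + l) \<le> v k * v l"
    and av: "(\<lambda>k. cmod (a k) * v k) summable_on UNIV"
    and "(\<lambda>n. 1 / root n (v (- int n))) \<longlonglongrightarrow> 1" "(\<lambda>n. root n (v (int n))) \<longlonglongrightarrow> 1"
  \<comment> \<open>The hypothesis at negative indices concerns the reciprocal of the root;
    inverting the limit gives the form in the locale.\<close>
  then interpret grs_weight v
    using tendsto_divide[of "\<lambda>_. 1" 1 sequentially "\<lambda>n. 1 / root n (v (- int n))" 1]
    by unfold_locales simp_all
  obtain C where "wbound v C \<alpha>"
    using inverse_wbound[OF assms summable_imp_wbound[OF av nonneg]
        inverse_matrix_toeplitz_column[OF assms \<alpha>]] .
  then show "(\<lambda>k. cmod (\<alpha> k) * v k) summable_on UNIV"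
    by (rule wbound_summable[OF _ nonneg])
next
  fix s :: real
  assume s: "1 < s" and a: "toeplitz a \<in> poly_decay s"
  interpret grs_decay "\<lambda>_. 2 powr s" "\<lambda>k. (1 + real_of_int \<bar>k\<bar>) powr (- s)"
    by (rule grs_decay_poly[OF s])
  obtain \<alpha> where \<alpha>: "inverse_matrix (toeplitz a) = toeplitz \<alpha>"
    using inverse_matrix_toeplitz[OF assms] by blast
  obtain c where c: "\<forall>k l. cmod (a (k - l)) < c * (1 + real_of_int \<bar>k - l\<bar>) powr (- s)"
    using a by (auto simp: poly_decay_def toeplitz_def)
  \<comment> \<open>Column 0 of the matrix bound is the bound on the sequence.\<close>
  have "cmod (a k) \<le> c * (1 + real_of_int \<bar>k\<bar>) powr (- s)" for k
    using c[rule_format, of k 0] by simp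
  then obtain C where C: "0 < C" "\<And>k. cmod (\<alpha> k) < C * (1 + real_of_int \<bar>k\<bar>) powr (- s)"
    using toeplitz_inverse_decay[OF assms \<alpha> _ summable_poly[OF s]] by blast
  have "toeplitz \<alpha> \<in> poly_decay s"
    unfolding poly_decay_def toeplitz_def
    by (rule CollectI, rule exI[of _ C]) (intro conjI allI C)
  then show "inverse_matrix (toeplitz a) \<in> poly_decay s"
    by (simp only: \<alpha>)
next
  fix \<gamma> \<beta> :: real
  assume \<gamma>\<beta>: "0 < \<gamma>" "0 < \<beta>" "\<beta> < 1" and a: "toeplitz a \<in> exp_decay \<gamma> \<beta>"
  interpret grs_decay "\<lambda>k. exp (\<gamma> * \<beta> * real_of_int \<bar>k\<bar> powr \<beta>)"
    "\<lambda>k. exp (- \<gamma> * real_of_int \<bar>k\<bar> powr \<beta>)"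
    by (rule grs_decay_exp[OF \<gamma>\<beta>])
  obtain \<alpha> where \<alpha>: "inverse_matrix (toeplitz a) = toeplitz \<alpha>"
    using inverse_matrix_toeplitz[OF assms] by blast
  obtain c where c: "\<forall>k l. cmod (a (k - l)) < c * exp (- \<gamma> * real_of_int \<bar>k - l\<bar> powr \<beta>)"
    using a by (auto simp: exp_decay_def toeplitz_def)
  have "cmod (a k) \<le> c * exp (- \<gamma> * real_of_int \<bar>k\<bar> powr \<beta>)" for k
    using c[rule_format, of k 0] by simp
  then obtain C where C: "0 < C" "\<And>k. cmod (\<alpha> k) < C * exp (- \<gamma> * real_of_int \<bar>k\<bar> powr \<beta>)"
    using toeplitz_inverse_decay[OF assms \<alpha> _ summable_exp_powr[OF \<gamma>\<beta>]] by blast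
  have "toeplitz \<alpha> \<in> exp_decay \<gamma> \<beta>"
    unfolding exp_decay_def toeplitz_def
    by (rule CollectI, rule exI[of _ C]) (intro conjI allI C)
  then show "inverse_matrix (toeplitz a) \<in> exp_decay \<gamma> \<beta>"
    by (simp only: \<alpha>)
qed

end
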